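(* Let $(M_1^4,g)$ be a 4-dimensional Lorentzian manifold and let $\alpha:I\to M_1^4$ ($I\subset\mathbb{R}$ an open interval) be a null Cartan curve parametrized by pseudo-arc $t$, with Frenet frame $\{\xi=\alpha',N,W_1,W_2\}$ and Cartan curvatures $\sigma_1,\sigma_2$. Let $f:M_1^4\to\mathbb{R}$ be a smooth function that is eikonal along $\alpha$ and has vanishing Hessian, $H^f=0$. If $\alpha$ is a null $f$-eikonal slant helix in $M_1^4$, then the following system is satisfied along $\alpha$: $$\begin{cases} a_2\sigma_1+a_3\sigma_2=0,\\ a_1'-a_2=0,\\ a_2'+a_1\sigma_1+c=0,\\ a_3'+a_1\sigma_2=0,\end{cases}$$ where $a_1=g(\nabla f,\xi)$, $a_2=g(\nabla f,W_1)$, $a_3=g(\nabla f,W_2)$, and $c=g(\nabla f,N)$ is a non-zero constant.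
   Context: $(M_1^4,g)$ is a 4-dimensional Lorentzian manifold (signature $(-,+,+,+)$) with Levi-Civita connection $\nabla$. A curve $\alpha(t)$ is null if $g(\alpha',\alpha')=0$ and $\alpha'(t)\ne0$ for all $t$. Write $\alpha''=\nabla_{\alpha'}\alpha'$, $\alpha'''=\nabla_{\alpha'}\alpha''$. A null curve is parametrized by pseudo-arc if $g(\alpha'',\alpha'')=1$; it is a Cartan curve if $g(\alpha'',\alpha'')\neq0$ and $\{\alpha',\alpha'',\alpha'''\}$ is linearly independent for every $t$. The Frenet frame of a pseudo-arc parametrized Cartan curve is the frame $\{\xi=\alpha',N,W_1,W_2\}$ along $\alpha$, where $N$ is null, $g(\xi,N)=1$, each of $\xi,N$ is orthogonal to each of $W_1,W_2$, $\{W_1,W_2\}$ is orthonormal, and $$\nabla_\xi\xi=W_1,\quad \nabla_\xi N=\sigma_1W_1+\sigma_2W_2,\quad \nabla_\xi W_1=-\sigma_1\xi-N,\quad \nabla_\xi W_2=-\sigma_2\xi .$$ The smooth functions $\sigma_1,\sigma_2$ are the Cartan curvatures of $\alpha$. A prime on functions of $t$ denotes $d/dt$. The gradient $\nabla f$ is defined by $g(\nabla f,X)=X(f)$ for all vector fields $X$. $f$ is eikonal along $\alpha$ if $\|\nabla f\|=\sqrt{|g(\nabla f,\nabla f)|}$ is constant along $\alpha$. The Hessian is $H^f(X,Y)=g(\nabla_X(\mathrm{grad} f),Y)$; $H^f=0$ means that $\nabla f$ is parallel in $M_1^4$. For $f$ eikonal along $\alpha$, $\alpha$ is a null $f$-eikonal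 slant helix if $g(\nabla f,N)$ is a non-zero constant along $\alpha$; then $\nabla f$ is called its axis. *)

theory Defs
  imports "HOL-Analysis.Analysis" "HOL-Library.Function_Algebras"
begin

text \<open>Meant for open sets in a finite-dimensional domain: continuous differentiability of
  order Suc k is expressed by all directional derivatives being of class k.\<close>

primrec C_k_on :: "nat \<Rightarrow> 'a::real_normed_vector set \<Rightarrow> ('a \<Rightarrow> 'b::real_normed_vector) \<Rightarrow> bool" where
  "C_k_on 0 S f \<longleftrightarrow> continuous_on S f"
| "C_k_on (Suc k) S f \<longleftrightarrow>
     (\<forall>x\<in>S. f differentiable (at x)) \<and>
     (\<forall>v. C_k_on k S (\<lambda>x. frechet_derivative f (at x) v))"

definition smooth_on :: "'a::real_normed_vector set \<Rightarrow> ('a \<Rightarrow> 'b::real_normed_vector) \<Rightarrow> bool" where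
  "smooth_on S f \<longleftrightarrow> (\<forall>k. C_k_on k S f)"

text \<open>The manifold is a whole type. A chart is a pair
  of its domain and its coordinate map; the values of the map outside of the domain are
  irrelevant. The atlas need not be maximal.\<close>

type_synonym 'm chart = "'m set \<times> ('m \<Rightarrow> real^4)"

definition chart_inv :: "'m chart \<Rightarrow> real^4 \<Rightarrow> 'm" where
  "chart_inv c = inv_into (fst c) (snd c)"

definition smooth_atlas :: "'m::{t2_space,second_countable_topology} chart set \<Rightarrow> bool" where
  "smooth_atlas A \<longleftrightarrow>
     (\<Union>c\<in>A. fst c) = UNIV \<and>
     (\<forall>c\<in>A. open (fst c) \<and> open (snd c ` fst c) \<and>
             homeomorphism (fst c) (snd c ` fst c) (snd c) (chart_inv c)) \<and>
     (\<forall>c\<in>A. \<forall>d\<in>A. smooth_on (snd c ` (fst c \<inter> fst d)) (snd d \<circ> chart_inv c))"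

definition charts_at :: "'m chart set \<Rightarrow> 'm \<Rightarrow> 'm chart set" where
  "charts_at A p = {c \<in> A. p \<in> fst c}"

definition smooth_function :: "'m chart set \<Rightarrow> ('m \<Rightarrow> real) \<Rightarrow> bool" where
  "smooth_function A f \<longleftrightarrow> (\<forall>c\<in>A. smooth_on (snd c ` fst c) (f \<circ> chart_inv c))"

text \<open>A tangent vector at p is a family of coordinate vectors, one for each chart around p, related
  by the Jacobians of the chart transitions. It is 0 by convention at all other charts, so that
  equality of tangent vectors is equality of functions. The operations on families are pointwise.\<close>

type_synonym 'm tvec = "'m chart \<Rightarrow> real^4"

definition scale_tvec :: "real \<Rightarrow> 'm tvec \<Rightarrow> 'm tvec" (infixr "*\<^sub>T" 75) where
  "r *\<^sub>T v = (\<lambda>c. r *\<^sub>R v c)"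

definition tangent_space :: "'m chart set \<Rightarrow> 'm \<Rightarrow> 'm tvec set" where
  "tangent_space A p =
     {v. (\<forall>c. c \<notin> charts_at A p \<longrightarrow> v c = 0) \<and>
         (\<forall>c\<in>charts_at A p. \<forall>d\<in>charts_at A p.
            v d = frechet_derivative (snd d \<circ> chart_inv c) (at (snd c p)) (v c))}"

definition coord_vec :: "'m chart set \<Rightarrow> 'm chart \<Rightarrow> 'm \<Rightarrow> 4 \<Rightarrow> 'm tvec" where
  "coord_vec A c p i =
     (\<lambda>d. if d \<in> charts_at A p
          then frechet_derivative (snd d \<circ> chart_inv c) (at (snd c p)) (axis i 1) else 0)"

text \<open>The number v(f), which does not depend on the chart used to compute it.\<close>

definition tvec_apply :: "'m chart set \<Rightarrow> 'm \<Rightarrow> 'm tvec \<Rightarrow> ('m \<Rightarrow> real) \<Rightarrow> real" where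
  "tvec_apply A p v f =
     (THE r. \<forall>c\<in>charts_at A p. r = frechet_derivative (f \<circ> chart_inv c) (at (snd c p)) (v c))"

type_synonym 'm metric = "'m \<Rightarrow> 'm tvec \<Rightarrow> 'm tvec \<Rightarrow> real"

definition metric_matrix :: "'m chart set \<Rightarrow> 'm metric \<Rightarrow> 'm chart \<Rightarrow> 'm \<Rightarrow> real^4^4" where
  "metric_matrix A g c p = (\<chi> i j. g p (coord_vec A c p i) (coord_vec A c p j))"

text \<open>Four vectors of a 4-dimensional space with the Gram matrix diag(-1,1,1,1) form a basis, so
  the last condition says that g p is nondegenerate of signature (-,+,+,+).
  The index type 4 has the elements 0, 1, 2, 3.\<close>

definition lorentzian_metric :: "'m chart set \<Rightarrow> 'm metric \<Rightarrow> bool" where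
  "lorentzian_metric A g \<longleftrightarrow>
     (\<forall>p. \<forall>u\<in>tangent_space A p. \<forall>v\<in>tangent_space A p. g p u v = g p v u) \<and>
     (\<forall>p r s. \<forall>u\<in>tangent_space A p. \<forall>v\<in>tangent_space A p. \<forall>w\<in>tangent_space A p.
        g p (r *\<^sub>T u + s *\<^sub>T v) w = r * g p u w + s * g p v w) \<and>
     (\<forall>c\<in>A. smooth_on (snd c ` fst c) (metric_matrix A g c \<circ> chart_inv c)) \<and>
     (\<forall>p. \<exists>e :: 4 \<Rightarrow> 'm tvec. (\<forall>i. e i \<in> tangent_space A p) \<and>
        (\<forall>i j. g p (e i) (e j) = (if i \<noteq> j then 0 else if i = 0 then -1 else 1)))"

definition lorentzian_manifold ::
  "'m::{t2_space,second_countable_topology} chart set \<Rightarrow> 'm metric \<Rightarrow> bool" where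
  "lorentzian_manifold A g \<longleftrightarrow> smooth_atlas A \<and> lorentzian_metric A g"

definition coord_deriv :: "'m chart \<Rightarrow> 4 \<Rightarrow> ('m \<Rightarrow> real) \<Rightarrow> 'm \<Rightarrow> real" where
  "coord_deriv c i h p = frechet_derivative (h \<circ> chart_inv c) (at (snd c p)) (axis i 1)"

definition christoffel ::
  "'m chart set \<Rightarrow> 'm metric \<Rightarrow> 'm chart \<Rightarrow> 'm \<Rightarrow> 4 \<Rightarrow> 4 \<Rightarrow> 4 \<Rightarrow> real" where
  "christoffel A g c p k i j =
     (1/2) * (\<Sum>l\<in>UNIV. matrix_inv (metric_matrix A g c p) $ k $ l *
        (coord_deriv c i (\<lambda>q. metric_matrix A g c q $ j $ l) p +
         coord_deriv c j (\<lambda>q. metric_matrix A g c q $ i $ l) p -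
         coord_deriv c l (\<lambda>q. metric_matrix A g c q $ i $ j) p))"

definition connection_form ::
  "'m chart set \<Rightarrow> 'm metric \<Rightarrow> 'm chart \<Rightarrow> 'm \<Rightarrow> real^4 \<Rightarrow> real^4 \<Rightarrow> real^4" where
  "connection_form A g c p u w =
     (\<chi> k. \<Sum>i\<in>UNIV. \<Sum>j\<in>UNIV. christoffel A g c p k i j * u $ i * w $ j)"

text \<open>The following lemmas lead to the characterization of the Christoffel symbols as the
  coefficients of the torsion-free metric connection.\<close>

lemma smooth_on_differentiable: "smooth_on S f \<Longrightarrow> x \<in> S \<Longrightarrow> f differentiable (at x)"
  unfolding smooth_on_def using C_k_on.simps(2)[of 0 S f] by blast

lemma chart_inv_left: "p \<in> fst c \<Longrightarrow> smooth_atlas A \<Longrightarrow> c \<in> A \<Longrightarrow> chart_inv c (snd c p) = p"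
  unfolding smooth_atlas_def homeomorphism_def by blast

lemma chart_image_Int:
  assumes "smooth_atlas A" "c \<in> A" "open V"
  shows "open (snd c ` (fst c \<inter> V))"
proof -
  have hom: "homeomorphism (fst c) (snd c ` fst c) (snd c) (chart_inv c)"
    and o: "open (snd c ` fst c)"
    using assms unfolding smooth_atlas_def by auto
  have "openin (top_of_set (fst c)) (fst c \<inter> V)"
    using assms(3) by (simp add: openin_open_Int)
  then have "openin (top_of_set (snd c ` fst c)) (snd c ` (fst c \<inter> V))"
    using hom homeomorphism_imp_open_map by blast
  then show ?thesis using o openin_open_trans by blast
qed

lemma coord_vec_tangent:
  assumes "smooth_atlas A" "c \<in> charts_at A p"
  shows "coord_vec A c p i \<in> tangent_space A p"
proof -
  have "frechet_derivative (snd e \<circ> chart_inv c) (at (snd c p)) u =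
        frechet_derivative (snd e \<circ> chart_inv d) (at (snd d p))
          (frechet_derivative (snd d \<circ> chart_inv c) (at (snd c p)) u)"
    if d: "d \<in> charts_at A p" and e: "e \<in> charts_at A p" for d e u
  proof -
    have A: "c \<in> A" "d \<in> A" "e \<in> A" "p \<in> fst c" "p \<in> fst d" "p \<in> fst e"
      using assms d e by (auto simp: charts_at_def)
    have sm: "smooth_on (snd x ` (fst x \<inter> fst y)) (snd y \<circ> chart_inv x)"
      if "x \<in> A" "y \<in> A" for x y
      using assms(1) that unfolding smooth_atlas_def by blast
    have dif: "(snd y \<circ> chart_inv x) differentiable (at (snd x p))"
      if "x \<in> A" "y \<in> A" "p \<in> fst x" "p \<in> fst y" for x y
      using smooth_on_differentiable[OF sm] that by blast
    let ?x = "snd c p"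
    have pt: "(snd d \<circ> chart_inv c) ?x = snd d p"
      using chart_inv_left[OF A(4) assms(1) A(1)] by simp
    have D1: "((snd d \<circ> chart_inv c) has_derivative
        frechet_derivative (snd d \<circ> chart_inv c) (at ?x)) (at ?x)"
      using dif[OF A(1,2,4,5)] frechet_derivative_works by blast
    have D2: "((snd e \<circ> chart_inv d) has_derivative
        frechet_derivative (snd e \<circ> chart_inv d) (at (snd d p))) (at ((snd d \<circ> chart_inv c) ?x))"
      using dif[OF A(2,3,5,6)] frechet_derivative_works pt by metis
    note D = diff_chain_at[OF D1 D2]
    let ?W = "snd c ` (fst c \<inter> fst d)"
    have W: "open ?W" "?x \<in> ?W"
      using chart_image_Int[OF assms(1) A(1)] assms(1) A unfolding smooth_atlas_def by auto
    have eq: "((snd e \<circ> chart_inv d) \<circ> (snd d \<circ> chart_inv c)) y = (snd e \<circ> chart_inv c) y"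
      if "y \<in> ?W" for y
      using that chart_inv_left[OF _ assms(1) A(1)] chart_inv_left[OF _ assms(1) A(2)] by auto
    have "((snd e \<circ> chart_inv c) has_derivative
        (frechet_derivative (snd e \<circ> chart_inv d) (at (snd d p)) \<circ>
         frechet_derivative (snd d \<circ> chart_inv c) (at ?x))) (at ?x)"
      by (rule has_derivative_transform_within_open[OF D W eq])
    from frechet_derivative_at[OF this] show ?thesis by (metis comp_apply)
  qed
  note J = this
  have "coord_vec A c p i e = frechet_derivative (snd e \<circ> chart_inv d) (at (snd d p)) (coord_vec A c p i d)"
    if "d \<in> charts_at A p" "e \<in> charts_at A p" for d e
    unfolding coord_vec_def using J[OF that, of "axis i 1"] by (simp only: that if_True)
  moreover have "coord_vec A c p i d = 0" if "d \<notin> charts_at A p" for d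
    using that by (simp add: coord_vec_def)
  ultimately show ?thesis unfolding tangent_space_def by blast
qed

lemma tangent_space_lincomb:
  assumes "smooth_atlas A" "v \<in> tangent_space A p" "w \<in> tangent_space A p"
  shows "r *\<^sub>T v + s *\<^sub>T w \<in> tangent_space A p"
proof -
  have "linear (frechet_derivative (snd d \<circ> chart_inv c) (at (snd c p)))"
    if "c \<in> charts_at A p" "d \<in> charts_at A p" for c d
  proof -
    have "smooth_on (snd c ` (fst c \<inter> fst d)) (snd d \<circ> chart_inv c)"
      using that assms(1) by (auto simp: charts_at_def smooth_atlas_def)
    then show ?thesis
      using smooth_on_differentiable that linear_frechet_derivative
      by (force simp: charts_at_def)
  qed
  note lin = this
  have "(r *\<^sub>T v + s *\<^sub>T w) d =
      frechet_derivative (snd d \<circ> chart_inv c) (at (snd c p)) ((r *\<^sub>T v + s *\<^sub>T w) c)"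
    if c: "c \<in> charts_at A p" and d: "d \<in> charts_at A p" for c d
  proof -
    have "v d = frechet_derivative (snd d \<circ> chart_inv c) (at (snd c p)) (v c)"
      "w d = frechet_derivative (snd d \<circ> chart_inv c) (at (snd c p)) (w c)"
      using assms(2,3) c d unfolding tangent_space_def by blast+
    then show ?thesis
      by (simp add: scale_tvec_def linear_add[OF lin[OF c d]] linear_cmul[OF lin[OF c d]])
  qed
  moreover have "(r *\<^sub>T v + s *\<^sub>T w) d = 0" if "d \<notin> charts_at A p" for d
  proof -
    have "v d = 0" "w d = 0" using assms(2,3) that unfolding tangent_space_def by blast+
    then show ?thesis by (simp add: scale_tvec_def)
  qed
  ultimately show ?thesis unfolding tangent_space_def by blast
qed

lemma metric_matrix_form:
  assumes M: "lorentzian_manifold A g" and c: "c \<in> charts_at A p"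
    and v: "v \<in> tangent_space A p" and w: "w \<in> tangent_space A p"
  shows "g p v w = v c \<bullet> (metric_matrix A g c p *v w c)"
proof -
  have at: "smooth_atlas A" using M by (simp add: lorentzian_manifold_def)
  have sym: "g p x y = g p y x"
    if "x \<in> tangent_space A p" "y \<in> tangent_space A p" for x y
    using M that by (simp add: lorentzian_manifold_def lorentzian_metric_def)
  have lin: "g p (r *\<^sub>T x + s *\<^sub>T y) z = r * g p x z + s * g p y z"
    if "x \<in> tangent_space A p" "y \<in> tangent_space A p" "z \<in> tangent_space A p" for r s x y z
    using M that by (simp add: lorentzian_manifold_def lorentzian_metric_def)
  let ?E = "\<lambda>i. coord_vec A c p i"
  have E: "?E i \<in> tangent_space A p" for i by (rule coord_vec_tangent[OF at c])
  have zero: "0 \<in> tangent_space A p"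
    using tangent_space_lincomb[OF at v v, of 0 0] by (simp add: scale_tvec_def zero_fun_def plus_fun_def)
  have sums: "(\<Sum>i\<in>S. a i *\<^sub>T ?E i) \<in> tangent_space A p \<and>
      (\<forall>z\<in>tangent_space A p. g p (\<Sum>i\<in>S. a i *\<^sub>T ?E i) z = (\<Sum>i\<in>S. a i * g p (?E i) z))"
    if "finite S" for S :: "4 set" and a
    using that
  proof (induction S)
    case empty
    have "g p 0 z = 0" if "z \<in> tangent_space A p" for z
      using lin[OF zero zero that, of 0 0] by (simp add: scale_tvec_def zero_fun_def plus_fun_def)
    then show ?case using zero by (simp add: zero_fun_def)
  next
    case (insert i S)
    let ?s = "\<Sum>i\<in>S. a i *\<^sub>T ?E i"
    have one: "1 *\<^sub>T ?s = ?s" by (simp add: scale_tvec_def)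
    have s: "?s \<in> tangent_space A p" using insert by blast
    have t: "(\<Sum>i\<in>insert i S. a i *\<^sub>T ?E i) = a i *\<^sub>T ?E i + 1 *\<^sub>T ?s"
      unfolding one using insert.hyps by simp
    have sv: "g p ?s z = (\<Sum>i\<in>S. a i * g p (?E i) z)" if "z \<in> tangent_space A p" for z
      using insert.IH that by blast
    have "g p (\<Sum>i\<in>insert i S. a i *\<^sub>T ?E i) z = (\<Sum>i\<in>insert i S. a i * g p (?E i) z)"
      if z: "z \<in> tangent_space A p" for z
      unfolding t lin[OF E s z] sv[OF z] using insert.hyps by simp
    moreover have "(\<Sum>i\<in>insert i S. a i *\<^sub>T ?E i) \<in> tangent_space A p"
      unfolding t by (rule tangent_space_lincomb[OF at E s])
    ultimately show ?case by blast
  qed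
  have exp: "x = (\<Sum>i\<in>UNIV. (x c $ i) *\<^sub>T ?E i)" if x: "x \<in> tangent_space A p" for x
  proof
    fix d
    have app: "(\<Sum>i\<in>S. (x c $ i) *\<^sub>T ?E i) d = (\<Sum>i\<in>S. (x c $ i) *\<^sub>R ?E i d)" for S :: "4 set"
      by (induction S rule: infinite_finite_induct) (auto simp: scale_tvec_def)
    show "x d = (\<Sum>i\<in>UNIV. (x c $ i) *\<^sub>T ?E i) d"
    proof (cases "d \<in> charts_at A p")
      case True
      let ?J = "frechet_derivative (snd d \<circ> chart_inv c) (at (snd c p))"
      have "smooth_on (snd c ` (fst c \<inter> fst d)) (snd d \<circ> chart_inv c)"
        using True c at by (auto simp: charts_at_def smooth_atlas_def)
      then have "linear ?J"
        using smooth_on_differentiable True c linear_frechet_derivative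
        by (force simp: charts_at_def)
      then have "?J (\<Sum>i\<in>UNIV. (x c $ i) *\<^sub>R axis i 1) = (\<Sum>i\<in>UNIV. (x c $ i) *\<^sub>R ?J (axis i 1))"
        by (simp add: linear_sum linear_cmul)
      moreover have "(\<Sum>i\<in>UNIV. (x c $ i) *\<^sub>R axis i 1) = x c"
        using basis_expansion[of "x c"] by (simp add: scalar_mult_eq_scaleR)
      moreover have "x d = ?J (x c)" using x True c unfolding tangent_space_def by blast
      ultimately show ?thesis unfolding app using True by (simp add: coord_vec_def)
    next
      case False
      then have "x d = 0" using x unfolding tangent_space_def by blast
      then show ?thesis unfolding app using False by (simp add: coord_vec_def)
    qed
  qed
  have ex: "g p x z = (\<Sum>i\<in>UNIV. x c $ i * g p (?E i) z)"
    if x: "x \<in> tangent_space A p" and z: "z \<in> tangent_space A p" for x z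
  proof -
    have "g p x z = g p (\<Sum>i\<in>UNIV. (x c $ i) *\<^sub>T ?E i) z"
      using exp[OF x] by (rule arg_cong)
    then show ?thesis using sums[of UNIV "\<lambda>i. x c $ i"] z by simp
  qed
  have "g p v w = (\<Sum>i\<in>UNIV. v c $ i * g p (?E i) w)" by (rule ex[OF v w])
  also have "\<dots> = (\<Sum>i\<in>UNIV. v c $ i * (\<Sum>j\<in>UNIV. w c $ j * g p (?E j) (?E i)))"
    unfolding sym[OF E w] ex[OF w E] ..
  also have "\<dots> = v c \<bullet> (metric_matrix A g c p *v w c)"
  proof -
    have "(metric_matrix A g c p *v w c) $ i = (\<Sum>j\<in>UNIV. w c $ j * g p (?E j) (?E i))" for i
      unfolding matrix_vector_mult_def metric_matrix_def using sym[OF E E, of i]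
      by (simp add: mult.commute)
    then show ?thesis by (simp add: inner_vec_def)
  qed
  finally show ?thesis .
qed

lemma metric_matrix_sym:
  assumes "lorentzian_manifold A g" "c \<in> charts_at A p"
  shows "metric_matrix A g c p $ i $ j = metric_matrix A g c p $ j $ i"
proof -
  have at: "smooth_atlas A"
    using assms(1) by (simp add: lorentzian_manifold_def)
  have "g p (coord_vec A c p i) (coord_vec A c p j) = g p (coord_vec A c p j) (coord_vec A c p i)"
    using assms(1) coord_vec_tangent[OF at assms(2), of i] coord_vec_tangent[OF at assms(2), of j]
    unfolding lorentzian_manifold_def lorentzian_metric_def by (elim conjE) simp
  then show ?thesis by (simp add: metric_matrix_def)
qed

lemma metric_matrix_invertible:
  assumes M: "lorentzian_manifold A g" and c: "c \<in> charts_at A p"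
  shows "invertible (metric_matrix A g c p)"
proof -
  let ?G = "metric_matrix A g c p"
  obtain e :: "4 \<Rightarrow> 'a tvec" where e: "\<And>i. e i \<in> tangent_space A p"
    "\<And>i j. g p (e i) (e j) = (if i \<noteq> j then 0 else if i = 0 then -1 else 1)"
  proof -
    have "\<exists>e :: 4 \<Rightarrow> 'a tvec. (\<forall>i. e i \<in> tangent_space A p) \<and>
        (\<forall>i j. g p (e i) (e j) = (if i \<noteq> j then 0 else if i = 0 then -1 else 1))"
      using M unfolding lorentzian_manifold_def lorentzian_metric_def by (elim conjE) (erule spec)
    then show thesis using that by blast
  qed
  define B :: "real^4^4" where "B = (\<chi> i. e i c)"
  define s :: "real^4^4" where "s = (\<chi> i j. if i \<noteq> j then 0 else if i = 0 then -1 else 1)"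
  have "(B ** (?G ** transpose B)) $ i $ j = s $ i $ j" for i j
  proof -
    have "(B ** (?G ** transpose B)) $ i $ j = e i c \<bullet> (?G *v e j c)"
      by (simp add: B_def matrix_matrix_mult_def transpose_def inner_vec_def matrix_vector_mult_def)
    also have "\<dots> = g p (e i) (e j)" by (rule metric_matrix_form[OF M c e(1) e(1), symmetric])
    finally show ?thesis by (simp add: e(2) s_def)
  qed
  then have *: "B ** (?G ** transpose B) = s" by (simp add: vec_eq_iff)
  have "s ** s = mat 1"
  proof -
    have "(s ** s) $ i $ j = (mat 1 :: real^4^4) $ i $ j" for i j
    proof -
      have "(s ** s) $ i $ j = (\<Sum>k\<in>UNIV. if k = i then s $ i $ i * s $ i $ j else 0)"
        unfolding matrix_matrix_mult_def vec_lambda_beta by (rule sum.cong) (auto simp: s_def)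
      also have "\<dots> = s $ i $ i * s $ i $ j" by simp
      finally show ?thesis by (simp add: s_def mat_def)
    qed
    then show ?thesis by (simp add: vec_eq_iff)
  qed
  then have "det s * det s = 1" by (metis det_mul det_I)
  then have "det s \<noteq> 0" by auto
  then have "det ?G \<noteq> 0" unfolding *[symmetric] by (auto simp: det_mul)
  then show ?thesis by (simp add: invertible_det_nz)
qed

lemma coord_deriv_metric_matrix_sym:
  assumes M: "lorentzian_manifold A g" and c: "c \<in> charts_at A p"
  shows "coord_deriv c k (\<lambda>q. metric_matrix A g c q $ i $ j) p =
         coord_deriv c k (\<lambda>q. metric_matrix A g c q $ j $ i) p"
proof -
  have at: "smooth_atlas A" using M by (simp add: lorentzian_manifold_def)
  have cA: "c \<in> A" "p \<in> fst c" using c by (auto simp: charts_at_def)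
  let ?f = "\<lambda>i j. (\<lambda>q. metric_matrix A g c q $ i $ j) \<circ> chart_inv c"
  have o: "open (snd c ` fst c)" "snd c p \<in> snd c ` fst c"
    using at cA by (auto simp: smooth_atlas_def)
  have eq: "?f i j y = ?f j i y" if "y \<in> snd c ` fst c" for y i j
  proof -
    have "c \<in> charts_at A (chart_inv c y)"
      using that chart_inv_left[OF _ at cA(1)] cA by (auto simp: charts_at_def)
    then show ?thesis using metric_matrix_sym[OF M] by simp
  qed
  have "(?f j i has_derivative D) (at (snd c p))"
    if "(?f i j has_derivative D) (at (snd c p))" for D i j
    using that o eq by (rule has_derivative_transform_within_open)
  then have "(?f i j has_derivative D) (at (snd c p)) \<longleftrightarrow> (?f j i has_derivative D) (at (snd c p))" for D
    by blast
  then show ?thesis by (simp add: coord_deriv_def frechet_derivative_def)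
qed

text \<open>The coordinate fields commute, so a connection with the coefficients C is torsion-free iff C
  is symmetric in its lower indices; the second conjunct is compatibility with the metric.\<close>

lemma christoffel_levi_civita:
  assumes M: "lorentzian_manifold A g" and c: "c \<in> charts_at A p"
  shows "(\<forall>k i j. C k i j = C k j i) \<and>
         (\<forall>k i j. coord_deriv c k (\<lambda>q. metric_matrix A g c q $ i $ j) p =
            (\<Sum>l\<in>UNIV. C l k i * metric_matrix A g c p $ l $ j +
                       C l k j * metric_matrix A g c p $ i $ l))
         \<longleftrightarrow> C = christoffel A g c p"
proof -
  define G where "G = metric_matrix A g c p"
  define d where "d = (\<lambda>k i j. coord_deriv c k (\<lambda>q. metric_matrix A g c q $ i $ j) p)"
  have Gs: "G $ i $ j = G $ j $ i" for i j
    unfolding G_def by (rule metric_matrix_sym[OF M c])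
  have ds: "d k i j = d k j i" for k i j
    unfolding d_def by (rule coord_deriv_metric_matrix_sym[OF M c])
  have "invertible G" unfolding G_def by (rule metric_matrix_invertible[OF M c])
  then have inv: "G ** matrix_inv G = mat 1" "matrix_inv G ** G = mat 1"
    unfolding invertible_def matrix_inv_def by (metis (mono_tags, lifting) someI_ex)+
  have i1: "(\<Sum>l\<in>UNIV. matrix_inv G $ k $ l * G $ l $ m) = (if k = m then 1 else 0)" for k m
    using inv(2) by (simp add: matrix_matrix_mult_def mat_def vec_eq_iff)
  have i2: "(\<Sum>l\<in>UNIV. G $ k $ l * matrix_inv G $ l $ m) = (if k = m then 1 else 0)" for k m
    using inv(1) by (simp add: matrix_matrix_mult_def mat_def vec_eq_iff)
  have delta: "(\<Sum>l\<in>UNIV. h l * (if n = l then 1 else 0)) = h n" for h :: "4 \<Rightarrow> real" and n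
  proof -
    have "(\<Sum>l\<in>UNIV. h l * (if n = l then 1 else 0)) = (\<Sum>l\<in>UNIV. if n = l then h l else 0)"
      by (rule sum.cong) auto
    then show ?thesis by simp
  qed
  have chr: "christoffel A g c p k i j =
      (1/2) * (\<Sum>l\<in>UNIV. matrix_inv G $ k $ l * (d i j l + d j i l - d l i j))" for k i j
    by (simp add: christoffel_def G_def d_def)
  have low: "(\<Sum>k\<in>UNIV. christoffel A g c p k i j * G $ k $ n) = (d i j n + d j i n - d n i j) / 2"
    for i j n
  proof -
    let ?b = "\<lambda>l. (d i j l + d j i l - d l i j) / 2"
    have "(\<Sum>k\<in>UNIV. christoffel A g c p k i j * G $ k $ n) =
      (\<Sum>k\<in>UNIV. \<Sum>l\<in>UNIV. ?b l * (G $ n $ k * matrix_inv G $ k $ l))"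
      unfolding chr Gs[of _ n] by (simp add: sum_distrib_left sum_distrib_right algebra_simps add_divide_distrib diff_divide_distrib)
    also have "\<dots> = (\<Sum>l\<in>UNIV. ?b l * (\<Sum>k\<in>UNIV. G $ n $ k * matrix_inv G $ k $ l))"
      by (subst sum.swap) (simp add: sum_distrib_left)
    also have "\<dots> = ?b n" unfolding i2 by (rule delta)
    finally show ?thesis .
  qed
  have dsym: "christoffel A g c p k i j = christoffel A g c p k j i" for k i j
    unfolding chr using ds by (simp add: algebra_simps)
  have compat: "d k i j = (\<Sum>l\<in>UNIV. christoffel A g c p l k i * G $ l $ j +
                       christoffel A g c p l k j * G $ i $ l)" for k i j
    unfolding sum.distrib Gs[of i] low using ds[of k j i] ds[of i k j] ds[of j k i] by (simp add: field_simps)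
  have uniq: "C = christoffel A g c p"
    if s: "\<And>k i j. C k i j = C k j i"
      and m: "\<And>k i j. d k i j = (\<Sum>l\<in>UNIV. C l k i * G $ l $ j + C l k j * G $ i $ l)"
  proof -
    define L where "L = (\<lambda>i j n. \<Sum>m\<in>UNIV. C m i j * G $ m $ n)"
    have Ls: "L i j n = L j i n" for i j n unfolding L_def using s by metis
    have m': "d k i j = L k i j + L k j i" for k i j
      unfolding m L_def sum.distrib Gs[of i] ..
    have "(d i j n + d j i n - d n i j) = 2 * L i j n" for i j n
      unfolding m' using Ls[of i j] Ls[of i n] Ls[of j n] by simp
    then have "christoffel A g c p k i j = (\<Sum>l\<in>UNIV. matrix_inv G $ k $ l * L i j l)" for k i j
      unfolding chr by (simp add: sum_distrib_left)
    also have "\<dots> k i j = (\<Sum>l\<in>UNIV. \<Sum>m\<in>UNIV. C m i j * (matrix_inv G $ k $ l * G $ l $ m))" for k i j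
      unfolding L_def sum_distrib_left using Gs by (simp add: algebra_simps)
    also have "\<dots> k i j = C k i j" for k i j
      by (subst sum.swap) (simp only: sum_distrib_left[symmetric] i1 delta)
    finally show ?thesis by (intro ext) simp
  qed
  show ?thesis
  proof
    assume "C = christoffel A g c p"
    then show "(\<forall>k i j. C k i j = C k j i) \<and>
         (\<forall>k i j. coord_deriv c k (\<lambda>q. metric_matrix A g c q $ i $ j) p =
            (\<Sum>l\<in>UNIV. C l k i * metric_matrix A g c p $ l $ j +
                       C l k j * metric_matrix A g c p $ i $ l))"
      using dsym compat unfolding d_def G_def by auto
  next
    assume "(\<forall>k i j. C k i j = C k j i) \<and>
         (\<forall>k i j. coord_deriv c k (\<lambda>q. metric_matrix A g c q $ i $ j) p =
            (\<Sum>l\<in>UNIV. C l k i * metric_matrix A g c p $ l $ j +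
                       C l k j * metric_matrix A g c p $ i $ l))"
    then show "C = christoffel A g c p"
      by (intro uniq) (auto simp: d_def G_def)
  qed
qed

text \<open>The derivative of the vector field Y at p in the direction v.\<close>

definition cov_deriv ::
  "'m chart set \<Rightarrow> 'm metric \<Rightarrow> 'm \<Rightarrow> 'm tvec \<Rightarrow> ('m \<Rightarrow> 'm tvec) \<Rightarrow> 'm tvec" where
  "cov_deriv A g p v Y =
     (\<lambda>c. if c \<in> charts_at A p
          then frechet_derivative (\<lambda>x. Y (chart_inv c x) c) (at (snd c p)) (v c)
               + connection_form A g c p (v c) (Y p c)
          else 0)"

definition gradient :: "'m chart set \<Rightarrow> 'm metric \<Rightarrow> ('m \<Rightarrow> real) \<Rightarrow> 'm \<Rightarrow> 'm tvec" where
  "gradient A g f p =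
     (THE w. w \<in> tangent_space A p \<and> (\<forall>v\<in>tangent_space A p. g p w v = tvec_apply A p v f))"

definition hessian ::
  "'m chart set \<Rightarrow> 'm metric \<Rightarrow> ('m \<Rightarrow> real) \<Rightarrow> 'm \<Rightarrow> 'm tvec \<Rightarrow> 'm tvec \<Rightarrow> real" where
  "hessian A g f p v w = g p (cov_deriv A g p v (gradient A g f)) w"

definition vanishing_hessian :: "'m chart set \<Rightarrow> 'm metric \<Rightarrow> ('m \<Rightarrow> real) \<Rightarrow> bool" where
  "vanishing_hessian A g f \<longleftrightarrow>
     (\<forall>p. \<forall>v\<in>tangent_space A p. \<forall>w\<in>tangent_space A p. hessian A g f p v w = 0)"

definition smooth_curve :: "'m::topological_space chart set \<Rightarrow> real set \<Rightarrow> (real \<Rightarrow> 'm) \<Rightarrow> bool" where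
  "smooth_curve A I \<alpha> \<longleftrightarrow>
     continuous_on I \<alpha> \<and> (\<forall>c\<in>A. smooth_on {t \<in> I. \<alpha> t \<in> fst c} (snd c \<circ> \<alpha>))"

definition velocity :: "'m chart set \<Rightarrow> (real \<Rightarrow> 'm) \<Rightarrow> real \<Rightarrow> 'm tvec" where
  "velocity A \<alpha> t =
     (\<lambda>c. if c \<in> charts_at A (\<alpha> t) then vector_derivative (snd c \<circ> \<alpha>) (at t) else 0)"

definition smooth_field_along ::
  "'m chart set \<Rightarrow> real set \<Rightarrow> (real \<Rightarrow> 'm) \<Rightarrow> (real \<Rightarrow> 'm tvec) \<Rightarrow> bool" where
  "smooth_field_along A I \<alpha> V \<longleftrightarrow>
     (\<forall>t\<in>I. V t \<in> tangent_space A (\<alpha> t)) \<and>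
     (\<forall>c\<in>A. smooth_on {t \<in> I. \<alpha> t \<in> fst c} (\<lambda>t. V t c))"

definition cov_deriv_along ::
  "'m chart set \<Rightarrow> 'm metric \<Rightarrow> (real \<Rightarrow> 'm) \<Rightarrow> (real \<Rightarrow> 'm tvec) \<Rightarrow> real \<Rightarrow> 'm tvec" where
  "cov_deriv_along A g \<alpha> V t =
     (\<lambda>c. if c \<in> charts_at A (\<alpha> t)
          then vector_derivative (\<lambda>s. V s c) (at t)
               + connection_form A g c (\<alpha> t) (velocity A \<alpha> t c) (V t c)
          else 0)"

definition acceleration :: "'m chart set \<Rightarrow> 'm metric \<Rightarrow> (real \<Rightarrow> 'm) \<Rightarrow> real \<Rightarrow> 'm tvec" where
  "acceleration A g \<alpha> = cov_deriv_along A g \<alpha> (velocity A \<alpha>)"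

definition jerk :: "'m chart set \<Rightarrow> 'm metric \<Rightarrow> (real \<Rightarrow> 'm) \<Rightarrow> real \<Rightarrow> 'm tvec" where
  "jerk A g \<alpha> = cov_deriv_along A g \<alpha> (acceleration A g \<alpha>)"

definition null_curve :: "'m::topological_space chart set \<Rightarrow> 'm metric \<Rightarrow> real set \<Rightarrow> (real \<Rightarrow> 'm) \<Rightarrow> bool" where
  "null_curve A g I \<alpha> \<longleftrightarrow>
     smooth_curve A I \<alpha> \<and>
     (\<forall>t\<in>I. g (\<alpha> t) (velocity A \<alpha> t) (velocity A \<alpha> t) = 0 \<and> velocity A \<alpha> t \<noteq> 0)"

definition cartan_curve :: "'m::topological_space chart set \<Rightarrow> 'm metric \<Rightarrow> real set \<Rightarrow> (real \<Rightarrow> 'm) \<Rightarrow> bool" where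
  "cartan_curve A g I \<alpha> \<longleftrightarrow>
     null_curve A g I \<alpha> \<and>
     (\<forall>t\<in>I. g (\<alpha> t) (acceleration A g \<alpha> t) (acceleration A g \<alpha> t) \<noteq> 0) \<and>
     (\<forall>t\<in>I. \<forall>r s q. r *\<^sub>T velocity A \<alpha> t + s *\<^sub>T acceleration A g \<alpha> t + q *\<^sub>T jerk A g \<alpha> t = 0
              \<longrightarrow> r = 0 \<and> s = 0 \<and> q = 0)"

definition pseudo_arc_parametrized :: "'m chart set \<Rightarrow> 'm metric \<Rightarrow> real set \<Rightarrow> (real \<Rightarrow> 'm) \<Rightarrow> bool" where
  "pseudo_arc_parametrized A g I \<alpha> \<longleftrightarrow>
     (\<forall>t\<in>I. g (\<alpha> t) (acceleration A g \<alpha> t) (acceleration A g \<alpha> t) = 1)"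

definition frenet_frame ::
  "'m chart set \<Rightarrow> 'm metric \<Rightarrow> real set \<Rightarrow> (real \<Rightarrow> 'm) \<Rightarrow>
   (real \<Rightarrow> 'm tvec) \<Rightarrow> (real \<Rightarrow> 'm tvec) \<Rightarrow> (real \<Rightarrow> 'm tvec) \<Rightarrow> (real \<Rightarrow> 'm tvec) \<Rightarrow>
   (real \<Rightarrow> real) \<Rightarrow> (real \<Rightarrow> real) \<Rightarrow> bool" where
  "frenet_frame A g I \<alpha> \<xi> N W1 W2 \<sigma>1 \<sigma>2 \<longleftrightarrow>
     \<xi> = velocity A \<alpha> \<and>
     smooth_field_along A I \<alpha> N \<and> smooth_field_along A I \<alpha> W1 \<and> smooth_field_along A I \<alpha> W2 \<and>
     smooth_on I \<sigma>1 \<and> smooth_on I \<sigma>2 \<and>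
     (\<forall>t\<in>I.
        g (\<alpha> t) (N t) (N t) = 0 \<and> g (\<alpha> t) (\<xi> t) (N t) = 1 \<and>
        g (\<alpha> t) (\<xi> t) (W1 t) = 0 \<and> g (\<alpha> t) (\<xi> t) (W2 t) = 0 \<and>
        g (\<alpha> t) (N t) (W1 t) = 0 \<and> g (\<alpha> t) (N t) (W2 t) = 0 \<and>
        g (\<alpha> t) (W1 t) (W1 t) = 1 \<and> g (\<alpha> t) (W2 t) (W2 t) = 1 \<and> g (\<alpha> t) (W1 t) (W2 t) = 0 \<and>
        cov_deriv_along A g \<alpha> \<xi> t = W1 t \<and>
        cov_deriv_along A g \<alpha> N t = \<sigma>1 t *\<^sub>T W1 t + \<sigma>2 t *\<^sub>T W2 t \<and>
        cov_deriv_along A g \<alpha> W1 t = - (\<sigma>1 t *\<^sub>T \<xi> t) - N t \<and>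
        cov_deriv_along A g \<alpha> W2 t = - (\<sigma>2 t *\<^sub>T \<xi> t))"

definition eikonal_along ::
  "'m chart set \<Rightarrow> 'm metric \<Rightarrow> real set \<Rightarrow> (real \<Rightarrow> 'm) \<Rightarrow> ('m \<Rightarrow> real) \<Rightarrow> bool" where
  "eikonal_along A g I \<alpha> f \<longleftrightarrow>
     (\<exists>k. \<forall>t\<in>I. sqrt \<bar>g (\<alpha> t) (gradient A g f (\<alpha> t)) (gradient A g f (\<alpha> t))\<bar> = k)"

text \<open>Here N is the null vector of the Frenet frame of the curve.\<close>

definition null_eikonal_slant_helix ::
  "'m chart set \<Rightarrow> 'm metric \<Rightarrow> real set \<Rightarrow> (real \<Rightarrow> 'm) \<Rightarrow> (real \<Rightarrow> 'm tvec) \<Rightarrow> ('m \<Rightarrow> real) \<Rightarrow> bool" where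
  "null_eikonal_slant_helix A g I \<alpha> N f \<longleftrightarrow>
     eikonal_along A g I \<alpha> f \<and>
     (\<exists>c. c \<noteq> 0 \<and> (\<forall>t\<in>I. g (\<alpha> t) (gradient A g f (\<alpha> t)) (N t) = c))"

end

theory Submission
  imports Defs
begin

text \<open>Since the Hessian of f vanishes, the gradient X of f is parallel, and the Levi-Civita connection
  is compatible with the metric. Hence for every field V along the curve the derivative of
  \<open>g(X, V)\<close> is \<open>g(X, \<nabla>\<^sub>\<xi> V)\<close>. Taking V to be \<open>\<xi>\<close>, W1 and W2 and inserting the Frenet equations gives
  the three differential equations; taking V to be N, where \<open>g(X, V)\<close> is the constant c, gives the
  algebraic equation. This product rule is \<open>has_real_derivative_gradient_along\<close>.

  What needs work is that X is parallel (\<open>cov_deriv_gradient_eq_0\<close>). The Hessian pairs the covariant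
  derivative of X with tangent vectors, and nondegeneracy of the metric shows that it vanishes once
  it is known to be a tangent vector itself, that is, once its coordinate expressions in different charts are
  known to be related by the Jacobians of the transition maps (\<open>cov_deriv_tangent\<close>). This is the transformation law
  of the Christoffel symbols, \<open>connection_form_transition\<close>. It follows from the uniqueness of the
  symmetric metric connection: the connection of one chart, pulled back to another one and corrected by
  the second derivative of the transition map, is again symmetric and metric. Symmetry amounts to the
  theorem of Schwarz on mixed derivatives (\<open>second_derivative_symmetric\<close>). Furthermore X must have
  differentiable coordinates; they solve a linear system whose matrix is the metric, so Cramer's rule
  applies.\<close>

section \<open>Derivatives of smooth maps between Euclidean spaces\<close>

lemma smooth_on_directional_derivative:
  "smooth_on S f \<Longrightarrow> smooth_on S (\<lambda>x. frechet_derivative f (at x) v)"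
  unfolding smooth_on_def using C_k_on.simps(2) by blast

lemma smooth_on_continuous_on: "smooth_on S f \<Longrightarrow> continuous_on S f"
  unfolding smooth_on_def using C_k_on.simps(1) by blast

lemma frechet_derivative_has_real_derivative_line:
  fixes h :: "'a::real_normed_vector \<Rightarrow> real"
  assumes "h differentiable (at (p + r *\<^sub>R v))"
  shows "((\<lambda>r. h (p + r *\<^sub>R v)) has_real_derivative
          frechet_derivative h (at (p + r *\<^sub>R v)) v) (at r)"
proof -
  let ?D = "frechet_derivative h (at (p + r *\<^sub>R v))"
  have h: "(h has_derivative ?D) (at (p + r *\<^sub>R v))"
    using assms frechet_derivative_works by blast
  have l: "((\<lambda>r. p + r *\<^sub>R v) has_derivative (\<lambda>s. s *\<^sub>R v)) (at r)"
    by (auto intro!: derivative_eq_intros)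
  have "((\<lambda>r. h (p + r *\<^sub>R v)) has_derivative (\<lambda>s. ?D (s *\<^sub>R v))) (at r)"
    using diff_chain_at[OF l h] by (simp add: o_def)
  moreover have "?D (s *\<^sub>R v) = ?D v * s" for s
    using linear_cmul[OF linear_frechet_derivative[OF assms]] by simp
  ultimately show ?thesis by (simp add: has_field_derivative_def)
qed

text \<open>The second difference of a function over a small parallelogram is \<open>s * s\<close> times a second
  derivative at a point of it: apply the mean value theorem along u to the increment of h in direction s v, then
  once more along v. The second difference does not change when u and v are exchanged, which is
  what makes mixed derivatives agree.\<close>

lemma second_difference_mean_value:
  fixes h :: "'a::real_normed_vector \<Rightarrow> real"
  assumes s: "0 < s"
    and U: "\<And>\<theta> \<eta>. 0 \<le> \<theta> \<Longrightarrow> \<theta> \<le> s \<Longrightarrow> 0 \<le> \<eta> \<Longrightarrow> \<eta> \<le> s \<Longrightarrow> x + \<theta> *\<^sub>R u + \<eta> *\<^sub>R v \<in> U"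
    and d: "\<And>y. y \<in> U \<Longrightarrow> h differentiable (at y)"
    and d2: "\<And>y. y \<in> U \<Longrightarrow> (\<lambda>z. frechet_derivative h (at z) u) differentiable (at y)"
  obtains \<theta> \<eta> where "0 < \<theta>" "\<theta> < s" "0 < \<eta>" "\<eta> < s"
    "h (x + s *\<^sub>R u + s *\<^sub>R v) - h (x + s *\<^sub>R u) - h (x + s *\<^sub>R v) + h x =
     s * s * frechet_derivative (\<lambda>z. frechet_derivative h (at z) u) (at (x + \<theta> *\<^sub>R u + \<eta> *\<^sub>R v)) v"
proof -
  let ?Du = "\<lambda>z. frechet_derivative h (at z) u"
  let ?k = "\<lambda>r. h (x + s *\<^sub>R v + r *\<^sub>R u) - h (x + r *\<^sub>R u)"
  have inU: "x + s *\<^sub>R v + r *\<^sub>R u \<in> U" "x + r *\<^sub>R u \<in> U" if "0 \<le> r" "r \<le> s" for r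
    using U[of r s] U[of r 0] that s by (auto simp: algebra_simps)
  have "(?k has_real_derivative ?Du (x + s *\<^sub>R v + r *\<^sub>R u) - ?Du (x + r *\<^sub>R u)) (at r)"
    if "0 \<le> r" "r \<le> s" for r
    by (intro DERIV_diff frechet_derivative_has_real_derivative_line d inU that)
  from MVT2[OF s this] obtain \<theta> where th: "0 < \<theta>" "\<theta> < s"
    "?k s - ?k 0 = (s - 0) * (?Du (x + s *\<^sub>R v + \<theta> *\<^sub>R u) - ?Du (x + \<theta> *\<^sub>R u))" by blast
  have "((\<lambda>r. ?Du (x + \<theta> *\<^sub>R u + r *\<^sub>R v)) has_real_derivative
     frechet_derivative ?Du (at (x + \<theta> *\<^sub>R u + r *\<^sub>R v)) v) (at r)"
    if "0 \<le> r" "r \<le> s" for r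
    by (intro frechet_derivative_has_real_derivative_line d2 U) (use th that in auto)
  from MVT2[OF s this] obtain \<eta> where et: "0 < \<eta>" "\<eta> < s"
    "?Du (x + \<theta> *\<^sub>R u + s *\<^sub>R v) - ?Du (x + \<theta> *\<^sub>R u + 0 *\<^sub>R v) =
     (s - 0) * frechet_derivative ?Du (at (x + \<theta> *\<^sub>R u + \<eta> *\<^sub>R v)) v" by blast
  have swap: "x + s *\<^sub>R v + \<theta> *\<^sub>R u = x + \<theta> *\<^sub>R u + s *\<^sub>R v" by simp
  have "?k s - ?k 0 = s * (?Du (x + \<theta> *\<^sub>R u + s *\<^sub>R v) - ?Du (x + \<theta> *\<^sub>R u))"
    unfolding th(3) swap by simp
  then have "?k s - ?k 0 = s * (s * frechet_derivative ?Du (at (x + \<theta> *\<^sub>R u + \<eta> *\<^sub>R v)) v)"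
    using et(3) by simp
  moreover have "?k s - ?k 0 =
      h (x + s *\<^sub>R u + s *\<^sub>R v) - h (x + s *\<^sub>R u) - h (x + s *\<^sub>R v) + h x"
    by (simp add: algebra_simps)
  ultimately show thesis using that th(1,2) et(1,2) by (simp add: mult.assoc)
qed

text \<open>Schwarz's theorem. If the two mixed derivatives at x differed, they would by continuity have
  disjoint ranges on a neighbourhood of x, while the second difference over a small enough
  parallelogram, divided by \<open>s * s\<close>, is a value of each of them.\<close>

lemma second_derivative_symmetric_real:
  fixes h :: "'a::real_normed_vector \<Rightarrow> real"
  assumes "open U" "x \<in> U" "smooth_on U h"
  shows "frechet_derivative (\<lambda>z. frechet_derivative h (at z) u) (at x) v =
         frechet_derivative (\<lambda>z. frechet_derivative h (at z) v) (at x) u"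
proof (rule ccontr)
  let ?D = "\<lambda>u v y. frechet_derivative (\<lambda>z. frechet_derivative h (at z) u) (at y) v"
  assume ne: "?D u v x \<noteq> ?D v u x"
  have diff: "h differentiable (at y)" "(\<lambda>z. frechet_derivative h (at z) w) differentiable (at y)"
    if "y \<in> U" for y w
    using that assms(3) smooth_on_directional_derivative smooth_on_differentiable by blast+
  have cont: "continuous (at x) (?D w w')" for w w'
    using smooth_on_continuous_on[OF smooth_on_directional_derivative[OF
        smooth_on_directional_derivative[OF assms(3)]]] assms(1,2) continuous_on_eq_continuous_at
    by blast
  let ?e = "\<bar>?D u v x - ?D v u x\<bar> / 2"
  have e: "?e > 0" using ne by simp
  obtain r1 where r1: "r1 > 0" "\<And>y. dist y x < r1 \<Longrightarrow> dist (?D u v y) (?D u v x) < ?e"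
    using cont[of u v] e unfolding continuous_at_eps_delta by blast
  obtain r2 where r2: "r2 > 0" "\<And>y. dist y x < r2 \<Longrightarrow> dist (?D v u y) (?D v u x) < ?e"
    using cont[of v u] e unfolding continuous_at_eps_delta by blast
  obtain r3 where r3: "r3 > 0" "ball x r3 \<subseteq> U"
    using assms(1,2) openE by blast
  define r where "r = min r1 (min r2 r3)"
  have r: "r > 0" using r1(1) r2(1) r3(1) by (simp add: r_def)
  define K where "K = norm u + norm v + 1"
  have K: "K > 0" by (simp add: K_def add_nonneg_pos)
  \<comment> \<open>With this s the parallelogram spanned by s u and s v at x lies within distance r of x.\<close>
  define s where "s = r / (2 * K)"
  have s: "s > 0" using r K by (simp add: s_def)
  have near: "dist (x + \<theta> *\<^sub>R u + \<eta> *\<^sub>R v) x < r"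
    if "0 \<le> \<theta>" "\<theta> \<le> s" "0 \<le> \<eta>" "\<eta> \<le> s" for \<theta> \<eta>
  proof -
    have "dist (x + \<theta> *\<^sub>R u + \<eta> *\<^sub>R v) x \<le> \<theta> * norm u + \<eta> * norm v"
      unfolding dist_norm using norm_triangle_ineq[of "\<theta> *\<^sub>R u" "\<eta> *\<^sub>R v"] that by simp
    also have "\<dots> \<le> s * norm u + s * norm v"
      using that by (intro add_mono mult_right_mono) auto
    also have "\<dots> \<le> s * K" using s by (simp add: K_def algebra_simps)
    also have "\<dots> = r / 2" using K by (simp add: s_def)
    also have "\<dots> < r" using r by simp
    finally show ?thesis .
  qed
  have inU: "y \<in> U" if "dist y x < r" for y
    using that r3(2) by (auto simp: r_def dist_commute subset_iff)
  obtain \<theta> \<eta> where A: "0 < \<theta>" "\<theta> < s" "0 < \<eta>" "\<eta> < s"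
    "h (x + s *\<^sub>R u + s *\<^sub>R v) - h (x + s *\<^sub>R u) - h (x + s *\<^sub>R v) + h x =
     s * s * ?D u v (x + \<theta> *\<^sub>R u + \<eta> *\<^sub>R v)"
    by (rule second_difference_mean_value[OF s inU[OF near] diff])
  have nearvu: "dist (x + \<theta> *\<^sub>R v + \<eta> *\<^sub>R u) x < r"
    if "0 \<le> \<theta>" "\<theta> \<le> s" "0 \<le> \<eta>" "\<eta> \<le> s" for \<theta> \<eta>
    using near[OF that(3,4,1,2)] by (simp add: add.assoc add.commute[of "\<eta> *\<^sub>R u"])
  obtain \<theta>' \<eta>' where B: "0 < \<theta>'" "\<theta>' < s" "0 < \<eta>'" "\<eta>' < s"
    "h (x + s *\<^sub>R v + s *\<^sub>R u) - h (x + s *\<^sub>R v) - h (x + s *\<^sub>R u) + h x =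
     s * s * ?D v u (x + \<theta>' *\<^sub>R v + \<eta>' *\<^sub>R u)"
    by (rule second_difference_mean_value[OF s inU[OF nearvu] diff])
  have swap: "x + s *\<^sub>R u + s *\<^sub>R v = x + s *\<^sub>R v + s *\<^sub>R u" by simp
  have "s * s * ?D u v (x + \<theta> *\<^sub>R u + \<eta> *\<^sub>R v) = s * s * ?D v u (x + \<theta>' *\<^sub>R v + \<eta>' *\<^sub>R u)"
    using A(5)[unfolded swap] B(5) by linarith
  then have eq: "?D u v (x + \<theta> *\<^sub>R u + \<eta> *\<^sub>R v) = ?D v u (x + \<theta>' *\<^sub>R v + \<eta>' *\<^sub>R u)"
    using s by simp
  have "dist (?D u v (x + \<theta> *\<^sub>R u + \<eta> *\<^sub>R v)) (?D u v x) < ?e"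
    using near[of \<theta> \<eta>] A(1-4) by (intro r1(2)) (auto simp: r_def)
  moreover have "dist (?D v u (x + \<theta>' *\<^sub>R v + \<eta>' *\<^sub>R u)) (?D v u x) < ?e"
    using nearvu[of \<theta>' \<eta>'] B(1-4) by (intro r2(2)) (auto simp: r_def)
  ultimately show False unfolding eq dist_real_def by (smt (verit) field_sum_of_halves)
qed

lemma frechet_derivative_inner_left:
  assumes "f differentiable (at x)"
  shows "frechet_derivative (\<lambda>y. f y \<bullet> b) (at x) v = frechet_derivative f (at x) v \<bullet> b"
proof -
  have "((\<lambda>y. f y \<bullet> b) has_derivative (\<lambda>v. frechet_derivative f (at x) v \<bullet> b)) (at x)"
    using assms frechet_derivative_works
    by (intro has_derivative_inner_left) blast
  then show ?thesis by (metis frechet_derivative_at)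
qed

text \<open>Reduces the vector-valued Schwarz theorem to the scalar one. Openness of S lets derivatives be
  computed from values on S, so the class k condition only sees these values.\<close>

lemma C_k_on_inner_left:
  assumes "open S"
  shows "C_k_on k S f \<Longrightarrow> C_k_on k S (\<lambda>y. f y \<bullet> b)"
proof (induction k arbitrary: f)
  case 0
  then show ?case by (auto intro!: continuous_intros)
next
  case (Suc k)
  have cong: "C_k_on j S p \<longleftrightarrow> C_k_on j S q" if "\<And>y. y \<in> S \<Longrightarrow> p y = q y" for j and p q :: "'a \<Rightarrow> real"
    using that
  proof (induction j arbitrary: p q)
    case 0
    then show ?case by (simp cong: continuous_on_cong)
  next
    case (Suc j)
    have D: "(p has_derivative d) (at y) \<longleftrightarrow> (q has_derivative d) (at y)" if "y \<in> S" for d y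
      using has_derivative_transform_within_open[OF _ assms that] Suc.prems by metis
    then have "p differentiable (at y) \<longleftrightarrow> q differentiable (at y)" if "y \<in> S" for y
      using that by (simp add: differentiable_def)
    moreover have "C_k_on j S (\<lambda>x. frechet_derivative p (at x) v) \<longleftrightarrow>
                   C_k_on j S (\<lambda>x. frechet_derivative q (at x) v)" for v
      by (rule Suc.IH) (simp add: frechet_derivative_def D)
    ultimately show ?case by simp
  qed
  have "(\<lambda>y. f y \<bullet> b) differentiable (at x)" if "x \<in> S" for x
    using Suc.prems that by (auto intro!: derivative_intros)
  moreover have "C_k_on k S (\<lambda>x. frechet_derivative (\<lambda>y. f y \<bullet> b) (at x) v)" for v
    using Suc cong[of "\<lambda>x. frechet_derivative (\<lambda>y. f y \<bullet> b) (at x) v" "\<lambda>x. frechet_derivative f (at x) v \<bullet> b"]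
    by (simp add: frechet_derivative_inner_left)
  ultimately show ?case by simp
qed

lemma second_derivative_symmetric:
  fixes f :: "'a::real_normed_vector \<Rightarrow> 'b::real_inner"
  assumes U: "open U" "x \<in> U" and sm: "smooth_on U f"
  shows "frechet_derivative (\<lambda>z. frechet_derivative f (at z) u) (at x) v =
         frechet_derivative (\<lambda>z. frechet_derivative f (at z) v) (at x) u"
proof -
  have inner: "frechet_derivative (\<lambda>z. frechet_derivative f (at z) u) (at x) v \<bullet> b =
      frechet_derivative (\<lambda>z. frechet_derivative (\<lambda>y. f y \<bullet> b) (at z) u) (at x) v" for u v b
  proof -
    have d: "(\<lambda>z. frechet_derivative f (at z) u) differentiable (at x)"
      using sm U(2) smooth_on_directional_derivative smooth_on_differentiable by blast
    have "frechet_derivative (\<lambda>z. frechet_derivative f (at z) u \<bullet> b) (at x) =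
          frechet_derivative (\<lambda>z. frechet_derivative (\<lambda>y. f y \<bullet> b) (at z) u) (at x)"
    proof (rule frechet_derivative_transform_within_open[OF _ U])
      show "(\<lambda>z. frechet_derivative f (at z) u \<bullet> b) differentiable (at x)"
        using d by (auto intro!: derivative_intros)
      show "frechet_derivative f (at y) u \<bullet> b = frechet_derivative (\<lambda>y. f y \<bullet> b) (at y) u"
        if "y \<in> U" for y
        using frechet_derivative_inner_left[OF smooth_on_differentiable[OF sm that]] by simp
    qed
    then show ?thesis using frechet_derivative_inner_left[OF d] by metis
  qed
  have sm': "smooth_on U (\<lambda>y. f y \<bullet> b)" for b
    using sm C_k_on_inner_left[OF U(1)] unfolding smooth_on_def by blast
  have "frechet_derivative (\<lambda>z. frechet_derivative f (at z) u) (at x) v \<bullet> b =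
        frechet_derivative (\<lambda>z. frechet_derivative f (at z) v) (at x) u \<bullet> b" for b
    unfolding inner by (rule second_derivative_symmetric_real[OF U sm'])
  then show ?thesis using vector_eq_rdot by blast
qed

lemma linear_Basis_expansion:
  fixes L :: "'a::euclidean_space \<Rightarrow> 'b::real_vector"
  assumes "linear L"
  shows "(\<Sum>b\<in>Basis. (a \<bullet> b) *\<^sub>R L b) = L a"
proof -
  have "L a = L (\<Sum>b\<in>Basis. (a \<bullet> b) *\<^sub>R b)" by (simp add: euclidean_representation)
  also have "\<dots> = (\<Sum>b\<in>Basis. (a \<bullet> b) *\<^sub>R L b)"
    by (simp add: linear_sum[OF assms] linear_cmul[OF assms])
  finally show ?thesis by simp
qed

text \<open>The product rule for the derivative of f applied to a varying vector. The hypothesis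
  provides derivatives of the directional derivatives for constant directions only, hence the
  expansion of w in a basis; symmetry of the second derivative then shows that the expression
  obtained is linear in w, so that the basis can be eliminated again.\<close>

lemma has_derivative_directional_derivative:
  fixes f :: "'a::euclidean_space \<Rightarrow> 'b::real_inner"
  assumes U: "open U" "x \<in> U" and sm: "smooth_on U f" and w: "(w has_derivative w') (at x)"
  shows "((\<lambda>y. frechet_derivative f (at y) (w y)) has_derivative
          (\<lambda>v. frechet_derivative (\<lambda>z. frechet_derivative f (at z) (w x)) (at x) v
               + frechet_derivative f (at x) (w' v))) (at x)"
proof -
  let ?H = "\<lambda>u v. frechet_derivative (\<lambda>z. frechet_derivative f (at z) u) (at x) v"
  have dH: "(\<lambda>z. frechet_derivative f (at z) u) differentiable (at x)" for u
    using smooth_on_differentiable[OF smooth_on_directional_derivative[OF sm] U(2)] .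
  have "((\<lambda>y. \<Sum>b\<in>Basis. (w y \<bullet> b) *\<^sub>R frechet_derivative f (at y) b) has_derivative
     (\<lambda>v. \<Sum>b\<in>Basis. (w x \<bullet> b) *\<^sub>R ?H b v + (w' v \<bullet> b) *\<^sub>R frechet_derivative f (at x) b)) (at x)"
    by (intro has_derivative_sum has_derivative_scaleR has_derivative_inner_left w
        dH[THEN frechet_derivative_works[THEN iffD1]])
  moreover have "(\<Sum>b\<in>Basis. (w x \<bullet> b) *\<^sub>R ?H b v + (w' v \<bullet> b) *\<^sub>R frechet_derivative f (at x) b)
     = ?H (w x) v + frechet_derivative f (at x) (w' v)" for v
  proof -
    have sym: "?H u v = ?H v u" for u by (rule second_derivative_symmetric[OF U sm])
    have "(\<Sum>b\<in>Basis. (w x \<bullet> b) *\<^sub>R ?H v b) = ?H v (w x)"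
      by (rule linear_Basis_expansion[OF linear_frechet_derivative[OF dH]])
    moreover have "(\<Sum>b\<in>Basis. (w' v \<bullet> b) *\<^sub>R frechet_derivative f (at x) b) = frechet_derivative f (at x) (w' v)"
      by (rule linear_Basis_expansion[OF linear_frechet_derivative[OF smooth_on_differentiable[OF sm U(2)]]])
    ultimately show ?thesis unfolding sum.distrib sym by simp
  qed
  ultimately have "((\<lambda>y. \<Sum>b\<in>Basis. (w y \<bullet> b) *\<^sub>R frechet_derivative f (at y) b) has_derivative
     (\<lambda>v. ?H (w x) v + frechet_derivative f (at x) (w' v))) (at x)" by simp
  then show ?thesis
  proof (rule has_derivative_transform_within_open[OF _ U])
    fix y assume "y \<in> U"
    then show "(\<Sum>b\<in>Basis. (w y \<bullet> b) *\<^sub>R frechet_derivative f (at y) b) = frechet_derivative f (at y) (w y)"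
      by (intro linear_Basis_expansion linear_frechet_derivative smooth_on_differentiable[OF sm])
  qed
qed

lemma bounded_bilinear_matrix_vector_mult:
  "bounded_bilinear ((*v) :: real^'n^'m \<Rightarrow> real^'n \<Rightarrow> real^'m)"
  unfolding bilinear_conv_bounded_bilinear[symmetric] bilinear_def
  by (auto intro!: linearI simp: matrix_vector_mult_add_rdistrib matrix_vector_right_distrib
      scaleR_matrix_vector_assoc matrix_vector_mult_scaleR)

lemma has_derivative_bilinear_form:
  fixes G :: "'a::real_normed_vector \<Rightarrow> real^'n^'m"
  assumes "(u has_derivative u') (at x)" "(G has_derivative G') (at x)" "(w has_derivative w') (at x)"
  shows "((\<lambda>y. u y \<bullet> (G y *v w y)) has_derivative
          (\<lambda>v. u' v \<bullet> (G x *v w x) + u x \<bullet> (G' v *v w x) + u x \<bullet> (G x *v w' v))) (at x)"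
proof -
  have "((\<lambda>y. G y *v w y) has_derivative (\<lambda>v. G x *v w' v + G' v *v w x)) (at x)"
    by (rule bounded_bilinear.FDERIV[OF bounded_bilinear_matrix_vector_mult assms(2,3)])
  from has_derivative_inner[OF assms(1) this] show ?thesis
    by (rule has_derivative_eq_rhs) (simp add: inner_add_right algebra_simps)
qed

lemma linear_eq_axis:
  fixes f g :: "real^'n \<Rightarrow> 'b::real_vector"
  assumes "linear f" "linear g" "\<And>i. f (axis i 1) = g (axis i 1)"
  shows "f x = g x"
proof -
  have "f = g"
    by (rule linear_eq_stdbasis[OF assms(1,2)]) (auto simp: Basis_vec_def assms(3))
  then show ?thesis by simp
qed

lemma trilinear_eq_axis:
  fixes f g :: "real^'n \<Rightarrow> real^'n \<Rightarrow> real^'n \<Rightarrow> 'b::real_vector"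
  assumes f: "\<And>u w. linear (\<lambda>v. f v u w)" "\<And>v w. linear (\<lambda>u. f v u w)" "\<And>v u. linear (f v u)"
    and g: "\<And>u w. linear (\<lambda>v. g v u w)" "\<And>v w. linear (\<lambda>u. g v u w)" "\<And>v u. linear (g v u)"
    and eq: "\<And>k i j. f (axis k 1) (axis i 1) (axis j 1) = g (axis k 1) (axis i 1) (axis j 1)"
  shows "f v u w = g v u w"
proof -
  have 1: "f (axis k 1) (axis i 1) w = g (axis k 1) (axis i 1) w" for k i w
    by (rule linear_eq_axis[OF f(3) g(3) eq])
  have 2: "f (axis k 1) u w = g (axis k 1) u w" for k u w
    by (rule linear_eq_axis[OF f(2) g(2) 1])
  show ?thesis by (rule linear_eq_axis[OF f(1) g(1) 2])
qed

section \<open>Tangent vectors and the metric in charts\<close>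

lemma chart_image:
  assumes "smooth_atlas A" "c \<in> charts_at A p"
  shows "open (snd c ` fst c)" "snd c p \<in> snd c ` fst c" "chart_inv c (snd c p) = p"
proof -
  have c: "c \<in> A" "p \<in> fst c" using assms(2) by (auto simp: charts_at_def)
  show "open (snd c ` fst c)" using assms(1) c(1) unfolding smooth_atlas_def by blast
  show "snd c p \<in> snd c ` fst c" using c(2) by blast
  show "chart_inv c (snd c p) = p" by (rule chart_inv_left[OF c(2) assms(1) c(1)])
qed

lemma chart_overlap:
  assumes "smooth_atlas A" "c \<in> charts_at A p" "d \<in> charts_at A p"
  shows "open (snd c ` (fst c \<inter> fst d))" "snd c p \<in> snd c ` (fst c \<inter> fst d)"
    and "smooth_on (snd c ` (fst c \<inter> fst d)) (snd d \<circ> chart_inv c)"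
    and "\<And>x. x \<in> snd c ` (fst c \<inter> fst d) \<Longrightarrow>
           c \<in> charts_at A (chart_inv c x) \<and> d \<in> charts_at A (chart_inv c x) \<and>
           snd c (chart_inv c x) = x"
proof -
  have c: "c \<in> A" "p \<in> fst c" and d: "d \<in> A" "p \<in> fst d"
    using assms(2,3) by (auto simp: charts_at_def)
  have "open (fst d)" using assms(1) d(1) unfolding smooth_atlas_def by blast
  then show "open (snd c ` (fst c \<inter> fst d))" by (rule chart_image_Int[OF assms(1) c(1)])
  show "snd c p \<in> snd c ` (fst c \<inter> fst d)" using c(2) d(2) by blast
  show "smooth_on (snd c ` (fst c \<inter> fst d)) (snd d \<circ> chart_inv c)"
    using assms(1) c(1) d(1) unfolding smooth_atlas_def by blast
  fix x assume "x \<in> snd c ` (fst c \<inter> fst d)"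
  then obtain q where q: "q \<in> fst c" "q \<in> fst d" "x = snd c q" by blast
  then have "chart_inv c x = q" using chart_inv_left[OF q(1) assms(1) c(1)] by simp
  then show "c \<in> charts_at A (chart_inv c x) \<and> d \<in> charts_at A (chart_inv c x) \<and>
      snd c (chart_inv c x) = x"
    using q c(1) d(1) by (simp add: charts_at_def)
qed

lemma transition_differentiable:
  assumes "smooth_atlas A" "c \<in> charts_at A p" "d \<in> charts_at A p"
  shows "(snd d \<circ> chart_inv c) differentiable (at (snd c p))"
  using chart_overlap[OF assms] smooth_on_differentiable by blast

lemma tangent_space_transition:
  assumes "v \<in> tangent_space A p" "c \<in> charts_at A p" "d \<in> charts_at A p"
  shows "v d = frechet_derivative (snd d \<circ> chart_inv c) (at (snd c p)) (v c)"
  using assms unfolding tangent_space_def by blast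

text \<open>Together with \<open>tangent_vector_eqI\<close>: a chart around p identifies the tangent space with the
  coordinate space. The coordinate vectors of c have the standard basis as their components.\<close>

lemma tangent_vector_with_coordinates:
  assumes at: "smooth_atlas A" and c: "c \<in> charts_at A p"
  obtains v where "v \<in> tangent_space A p" "v c = u"
proof -
  let ?S = "{u. \<exists>v\<in>tangent_space A p. v c = u}"
  have comb: "a *\<^sub>R x + b *\<^sub>R y \<in> ?S" if xy: "x \<in> ?S" "y \<in> ?S" for a b x y
  proof -
    obtain v where v: "v \<in> tangent_space A p" "v c = x" using xy(1) by auto
    obtain w where w: "w \<in> tangent_space A p" "w c = y" using xy(2) by auto
    have "(a *\<^sub>T v + b *\<^sub>T w) c = a *\<^sub>R x + b *\<^sub>R y" using v(2) w(2) by (simp add: scale_tvec_def)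
    then show ?thesis using tangent_space_lincomb[OF at v(1) w(1), of a b] by (intro CollectI bexI)
  qed
  have ax: "axis i 1 \<in> ?S" for i
  proof -
    have "((\<lambda>x. x) has_derivative (\<lambda>x. x)) (at (snd c p))" by (rule has_derivative_ident)
    then have "((snd c \<circ> chart_inv c) has_derivative (\<lambda>x. x)) (at (snd c p))"
      by (rule has_derivative_transform_within_open[OF _ chart_overlap(1,2)[OF at c c]])
        (use chart_overlap(4)[OF at c c] in auto)
    from frechet_derivative_at[OF this] have "coord_vec A c p i c = axis i 1"
      using c by (metis coord_vec_def)
    then show ?thesis using coord_vec_tangent[OF at c, of i] by (intro CollectI bexI)
  qed
  have "subspace ?S"
  proof (rule subspaceI)
    show "0 \<in> ?S" using comb[OF ax ax, of 0 0 0 0] by (simp only: scaleR_zero_left add_0)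
    show "x + y \<in> ?S" if "x \<in> ?S" "y \<in> ?S" for x y
      using comb[OF that, of 1 1] by (simp only: scaleR_one)
    show "r *\<^sub>R x \<in> ?S" if "x \<in> ?S" for r x
      using comb[OF that that, of r 0] by (simp only: scaleR_zero_left add_0_right)
  qed
  moreover have "Basis \<subseteq> ?S"
  proof
    fix b :: "real^4" assume "b \<in> Basis"
    then obtain i where "b = axis i 1" by (auto simp: Basis_vec_def)
    then show "b \<in> ?S" using ax by (simp only:)
  qed
  ultimately have "span Basis \<subseteq> ?S" by (rule span_minimal[rotated])
  then have "u \<in> ?S" unfolding span_Basis by (rule subsetD) (rule UNIV_I)
  then show thesis using that by auto
qed

lemma tangent_vector_eqI:
  assumes "v \<in> tangent_space A p" "w \<in> tangent_space A p" "c \<in> charts_at A p" "v c = w c"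
  shows "v = w"
proof
  fix d
  show "v d = w d"
  proof (cases "d \<in> charts_at A p")
    case True
    then show ?thesis using assms tangent_space_transition by metis
  next
    case False
    then have "v d = 0" "w d = 0" using assms(1,2) unfolding tangent_space_def by blast+
    then show ?thesis by simp
  qed
qed

text \<open>Nondegeneracy of the metric. It is stated for tangent vectors only, because the metric is
  arbitrary on families that are not tangent vectors.\<close>

lemma tangent_vector_eq_0:
  assumes M: "lorentzian_manifold A g" and v: "v \<in> tangent_space A p"
    and orth: "\<And>w. w \<in> tangent_space A p \<Longrightarrow> g p v w = 0"
    and c: "c \<in> charts_at A p"
  shows "v c = 0"
proof -
  have at: "smooth_atlas A" using M by (simp add: lorentzian_manifold_def)
  let ?G = "metric_matrix A g c p"
  obtain G' where "?G ** G' = mat 1"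
    using metric_matrix_invertible[OF M c] unfolding invertible_def by blast
  then have G': "?G *v (G' *v x) = x" for x by (simp add: matrix_vector_mul_assoc)
  obtain w where w: "w \<in> tangent_space A p" "w c = G' *v v c"
    using tangent_vector_with_coordinates[OF at c] .
  have "v c \<bullet> v c = g p v w" unfolding metric_matrix_form[OF M c v w(1)] w(2) G' ..
  then show ?thesis using orth[OF w(1)] by simp
qed

lemma metric_matrix_transition:
  assumes M: "lorentzian_manifold A g" and c: "c \<in> charts_at A p" and d: "d \<in> charts_at A p"
  defines "J \<equiv> frechet_derivative (snd d \<circ> chart_inv c) (at (snd c p))"
  shows "u \<bullet> (metric_matrix A g c p *v w) = J u \<bullet> (metric_matrix A g d p *v J w)"
proof -
  have at: "smooth_atlas A" using M by (simp add: lorentzian_manifold_def)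
  obtain v1 where v1: "v1 \<in> tangent_space A p" "v1 c = u"
    using tangent_vector_with_coordinates[OF at c] .
  obtain v2 where v2: "v2 \<in> tangent_space A p" "v2 c = w"
    using tangent_vector_with_coordinates[OF at c] .
  have "v1 d = J u" "v2 d = J w"
    using tangent_space_transition[OF v1(1) c d] tangent_space_transition[OF v2(1) c d] v1(2) v2(2)
    by (simp_all add: J_def)
  then show ?thesis
    using metric_matrix_form[OF M c v1(1) v2(1)] metric_matrix_form[OF M d v1(1) v2(1)] v1(2) v2(2)
    by metis
qed

section \<open>The Levi-Civita connection in charts\<close>

abbreviation metric_rep :: "'m chart set \<Rightarrow> 'm metric \<Rightarrow> 'm chart \<Rightarrow> real^4 \<Rightarrow> real^4^4" where
  "metric_rep A g c \<equiv> metric_matrix A g c \<circ> chart_inv c"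

lemma metric_rep_differentiable:
  assumes M: "lorentzian_manifold A g" and c: "c \<in> charts_at A p"
  shows "metric_rep A g c differentiable (at (snd c p))"
proof -
  have "smooth_on (snd c ` fst c) (metric_rep A g c)"
    using M c by (auto simp: lorentzian_manifold_def lorentzian_metric_def charts_at_def)
  then show ?thesis
    using smooth_on_differentiable c by (fastforce simp: charts_at_def)
qed

lemma coord_deriv_metric_matrix:
  assumes M: "lorentzian_manifold A g" and c: "c \<in> charts_at A p"
  shows "coord_deriv c k (\<lambda>q. metric_matrix A g c q $ i $ j) p =
         frechet_derivative (metric_rep A g c) (at (snd c p)) (axis k 1) $ i $ j"
proof -
  let ?D = "frechet_derivative (metric_rep A g c) (at (snd c p))"
  have "(metric_rep A g c has_derivative ?D) (at (snd c p))"
    using metric_rep_differentiable[OF M c] frechet_derivative_works by blast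
  then have "((\<lambda>x. metric_rep A g c x $ i $ j) has_derivative (\<lambda>v. ?D v $ i $ j)) (at (snd c p))"
    by (intro bounded_linear.has_derivative[OF bounded_linear_vec_nth])
  then have "(((\<lambda>q. metric_matrix A g c q $ i $ j) \<circ> chart_inv c) has_derivative (\<lambda>v. ?D v $ i $ j)) (at (snd c p))"
    by (simp add: o_def)
  from frechet_derivative_at[OF this] show ?thesis unfolding coord_deriv_def by metis
qed

lemma bilinear_connection_form: "bilinear (connection_form A g c p)"
  unfolding bilinear_def
  by (auto intro!: linearI simp: connection_form_def vec_eq_iff sum.distrib algebra_simps sum_distrib_left)

lemma connection_form_axis:
  "connection_form A g c p (axis i 1) (axis j 1) $ k = christoffel A g c p k i j"
proof -
  have "connection_form A g c p (axis i 1) (axis j 1) $ k = (\<Sum>i'\<in>UNIV. \<Sum>j'\<in>UNIV.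
      if j' = j then if i' = i then christoffel A g c p k i' j' else 0 else 0)"
    unfolding connection_form_def vec_lambda_beta
    by (intro sum.cong refl) (simp add: axis_def)
  then show ?thesis by simp
qed

text \<open>Translates compatibility of connection coefficients with the metric between its index form
  and the form without indices, in which the chain rule is convenient. Both sides are trilinear, so
  they need only be compared on basis vectors.\<close>

lemma metric_compatible_iff:
  assumes M: "lorentzian_manifold A g" and c: "c \<in> charts_at A p" and b: "bilinear b"
  shows "(\<forall>k i j. coord_deriv c k (\<lambda>q. metric_matrix A g c q $ i $ j) p =
            (\<Sum>l\<in>UNIV. b (axis k 1) (axis i 1) $ l * metric_matrix A g c p $ l $ j +
                       b (axis k 1) (axis j 1) $ l * metric_matrix A g c p $ i $ l))
     \<longleftrightarrow> (\<forall>v u w. u \<bullet> (frechet_derivative (metric_rep A g c) (at (snd c p)) v *v w) =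
            b v u \<bullet> (metric_matrix A g c p *v w) + u \<bullet> (metric_matrix A g c p *v b v w))"
    (is "(\<forall>k i j. ?L k i j = ?R k i j) \<longleftrightarrow> (\<forall>v u w. ?f v u w = ?h v u w)")
proof -
  let ?G = "metric_matrix A g c p"
  let ?D = "frechet_derivative (metric_rep A g c) (at (snd c p))"
  have entry: "a \<bullet> (B *v axis j 1) = (\<Sum>l\<in>UNIV. a $ l * B $ l $ j)"
    "axis i 1 \<bullet> (B *v a) = (\<Sum>l\<in>UNIV. a $ l * B $ i $ l)" for a :: "real^4" and B :: "real^4^4" and i j
    by (simp add: inner_vec_def matrix_vector_mult_basis column_def)
      (simp add: inner_axis' matrix_vector_mult_def mult.commute)
  have f: "?f (axis k 1) (axis i 1) (axis j 1) = ?L k i j" for k i j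
    unfolding coord_deriv_metric_matrix[OF M c]
    by (simp add: inner_axis' matrix_vector_mult_basis column_def)
  have h: "?h (axis k 1) (axis i 1) (axis j 1) = ?R k i j" for k i j
    unfolding entry by (simp add: sum.distrib)
  have linD: "linear ?D"
    by (rule linear_frechet_derivative[OF metric_rep_differentiable[OF M c]])
  have b1: "linear (\<lambda>v. b v u)" and b2: "linear (b v)" for u v
    using b by (auto simp: bilinear_def)
  note lin_simps = linear_add[OF linD] linear_cmul[OF linD] linear_add[OF b1] linear_cmul[OF b1]
    linear_add[OF b2] linear_cmul[OF b2] matrix_vector_mult_add_rdistrib matrix_vector_right_distrib
    scaleR_matrix_vector_assoc[symmetric] matrix_vector_mult_scaleR inner_add_left inner_add_right
  show ?thesis
  proof
    assume "\<forall>k i j. ?L k i j = ?R k i j"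
    then have eq: "?f (axis k 1) (axis i 1) (axis j 1) = ?h (axis k 1) (axis i 1) (axis j 1)" for k i j
      unfolding f h by blast
    have "?f v u w = ?h v u w" for v u w
      by (rule trilinear_eq_axis[where f = ?f and g = ?h, OF _ _ _ _ _ _ eq])
        (auto intro!: linearI simp: lin_simps distrib_left add_ac)
    then show "\<forall>v u w. ?f v u w = ?h v u w" by blast
  next
    assume "\<forall>v u w. ?f v u w = ?h v u w"
    then show "\<forall>k i j. ?L k i j = ?R k i j" unfolding f[symmetric] h[symmetric] by blast
  qed
qed

lemma connection_form_symmetric:
  assumes M: "lorentzian_manifold A g" and c: "c \<in> charts_at A p"
  shows "connection_form A g c p u w = connection_form A g c p w u"
proof -
  have sym: "christoffel A g c p k i j = christoffel A g c p k j i" for k i j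
    using christoffel_levi_civita[OF M c, of "christoffel A g c p"] by blast
  have "(\<Sum>i\<in>UNIV. \<Sum>j\<in>UNIV. christoffel A g c p k i j * u $ i * w $ j) =
        (\<Sum>j\<in>UNIV. \<Sum>i\<in>UNIV. christoffel A g c p k j i * w $ j * u $ i)" for k
    by (subst sum.swap, intro sum.cong refl, subst sym) simp
  then show ?thesis by (simp add: connection_form_def)
qed

lemma connection_form_metric:
  assumes M: "lorentzian_manifold A g" and c: "c \<in> charts_at A p"
  shows "u \<bullet> (frechet_derivative (metric_rep A g c) (at (snd c p)) v *v w) =
         connection_form A g c p v u \<bullet> (metric_matrix A g c p *v w)
         + u \<bullet> (metric_matrix A g c p *v connection_form A g c p v w)"
  using iffD1[OF metric_compatible_iff[OF M c bilinear_connection_form[of A g c p], unfolded connection_form_axis]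
      conjunct2[OF iffD2[OF christoffel_levi_civita[OF M c] refl]], rule_format] .

text \<open>Uniqueness of the Levi-Civita connection, for bilinear maps instead of arrays of symbols.\<close>

lemma connection_form_unique:
  assumes M: "lorentzian_manifold A g" and c: "c \<in> charts_at A p" and b: "bilinear b"
    and sym: "\<And>u w. b u w = b w u"
    and met: "\<And>v u w. u \<bullet> (frechet_derivative (metric_rep A g c) (at (snd c p)) v *v w) =
            b v u \<bullet> (metric_matrix A g c p *v w) + u \<bullet> (metric_matrix A g c p *v b v w)"
  shows "b u w = connection_form A g c p u w"
proof -
  let ?C = "\<lambda>k i j. b (axis i 1) (axis j 1) $ k"
  have C_sym: "\<forall>k i j. ?C k i j = ?C k j i"
    by (intro allI arg_cong[where f = "\<lambda>x. x $ _"] sym)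
  have "\<forall>v u w. u \<bullet> (frechet_derivative (metric_rep A g c) (at (snd c p)) v *v w) =
            b v u \<bullet> (metric_matrix A g c p *v w) + u \<bullet> (metric_matrix A g c p *v b v w)"
    by (intro allI met)
  note C_met = iffD2[OF metric_compatible_iff[OF M c b] this]
  have C: "?C = christoffel A g c p"
    by (rule iffD1[OF christoffel_levi_civita[OF M c], OF conjI[OF C_sym C_met]])
  have ax: "b (axis i 1) (axis j 1) = connection_form A g c p (axis i 1) (axis j 1)" for i j
  proof (rule vec_eq_iff[THEN iffD2], rule allI)
    show "b (axis i 1) (axis j 1) $ k = connection_form A g c p (axis i 1) (axis j 1) $ k" for k
      unfolding connection_form_axis C[symmetric] ..
  qed
  have lin: "linear (a x)" "linear (\<lambda>x. a x y)"
    if "bilinear a" for a :: "real^4 \<Rightarrow> real^4 \<Rightarrow> real^4" and x y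
    using that by (auto simp: bilinear_def)
  note lin_b = lin[OF b] and lin_c = lin[OF bilinear_connection_form]
  have "b (axis i 1) w = connection_form A g c p (axis i 1) w" for i w
    by (rule linear_eq_axis[OF lin_b(1) lin_c(1) ax])
  then show ?thesis by (rule linear_eq_axis[OF lin_b(2) lin_c(2)])
qed

text \<open>The transformation law of the Christoffel symbols. Rather than transforming the formula for
  the symbols, pull the connection form of the chart d back to c, adding the second derivative of
  the transition map \<open>\<phi>\<close>. The result is symmetric because second derivatives are, and it is compatible
  with the metric of c, as one sees by differentiating the transformation law of the metric
  matrix. By uniqueness it is the connection form of c.\<close>

lemma connection_form_transition:
  assumes M: "lorentzian_manifold A g" and c: "c \<in> charts_at A p" and d: "d \<in> charts_at A p"
  defines "\<phi> \<equiv> snd d \<circ> chart_inv c"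
  defines "J \<equiv> frechet_derivative \<phi> (at (snd c p))"
  shows "J (connection_form A g c p u w) =
         connection_form A g d p (J u) (J w)
         + frechet_derivative (\<lambda>y. frechet_derivative \<phi> (at y) w) (at (snd c p)) u"
proof -
  have at: "smooth_atlas A" using M by (simp add: lorentzian_manifold_def)
  let ?x = "snd c p" and ?U = "snd c ` (fst c \<inter> fst d)"
  let ?Gc = "metric_rep A g c" and ?Gd = "metric_rep A g d"
  define H where "H u w = frechet_derivative (\<lambda>y. frechet_derivative \<phi> (at y) w) (at ?x) u" for u w
  note U = chart_overlap(1,2)[OF at c d]
  have sm: "smooth_on ?U \<phi>" unfolding \<phi>_def by (rule chart_overlap(3)[OF at c d])
  have dphi: "(\<phi> has_derivative J) (at ?x)"
    using smooth_on_differentiable[OF sm U(2)] frechet_derivative_works unfolding J_def by blast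
  have linJ: "linear J" using dphi has_derivative_linear by blast
  have phix: "\<phi> ?x = snd d p" using chart_image[OF at c] by (simp add: \<phi>_def)
  have Hsym: "H u w = H w u" for u w
    unfolding H_def by (rule second_derivative_symmetric[OF U sm])
  have linH: "linear (\<lambda>u. H u w)" for w
    unfolding H_def
    by (rule linear_frechet_derivative[OF smooth_on_differentiable[OF smooth_on_directional_derivative[OF sm] U(2)]])
  have linH2: "linear (H w)" for w using linH[of w] Hsym by (metis (no_types, lifting) ext)
  define K where "K = frechet_derivative (snd c \<circ> chart_inv d) (at (snd d p))"
  have linK: "linear K" unfolding K_def by (rule linear_frechet_derivative[OF transition_differentiable[OF at d c]])
  have JK: "J (K z) = z" for z
  proof -
    obtain v where "v \<in> tangent_space A p" "v d = z" using tangent_vector_with_coordinates[OF at d] .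
    then show ?thesis unfolding J_def K_def \<phi>_def using tangent_space_transition c d by metis
  qed
  \<comment> \<open>K inverts the Jacobian J, so b is the connection form of d pulled back to the chart c.\<close>
  define b where "b u w = K (connection_form A g d p (J u) (J w) + H u w)" for u w
  have bil: "bilinear b"
    unfolding bilinear_def b_def
    using bilinear_connection_form[of A g d p]
    by (auto intro!: linearI simp: linear_add[OF linJ] linear_cmul[OF linJ] linear_add[OF linK] linear_cmul[OF linK]
        linear_add[OF linH] linear_cmul[OF linH] linear_add[OF linH2] linear_cmul[OF linH2]
        bilinear_ladd bilinear_radd bilinear_lmul bilinear_rmul scaleR_add_right)
  have bsym: "b u w = b w u" for u w
    unfolding b_def using Hsym connection_form_symmetric[OF M d] by metis
  have met: "u \<bullet> (frechet_derivative ?Gc (at ?x) v *v w) =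
            b v u \<bullet> (metric_matrix A g c p *v w) + u \<bullet> (metric_matrix A g c p *v b v w)" for u v w
  proof -
    have dc: "(?Gc has_derivative frechet_derivative ?Gc (at ?x)) (at ?x)"
      using metric_rep_differentiable[OF M c] frechet_derivative_works by blast
    have dd: "(?Gd has_derivative frechet_derivative ?Gd (at (snd d p))) (at (\<phi> ?x))"
      unfolding phix using metric_rep_differentiable[OF M d] frechet_derivative_works by blast
    have ddphi: "((\<lambda>y. ?Gd (\<phi> y)) has_derivative (\<lambda>v. frechet_derivative ?Gd (at (snd d p)) (J v))) (at ?x)"
      using diff_chain_at[OF dphi dd] by (simp add: o_def)
    have dJ: "((\<lambda>y. frechet_derivative \<phi> (at y) u) has_derivative (\<lambda>v. H v u)) (at ?x)" for u
      unfolding H_def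
      using smooth_on_differentiable[OF smooth_on_directional_derivative[OF sm] U(2)] frechet_derivative_works
      by fastforce
    have D1: "((\<lambda>y. u \<bullet> (?Gc y *v w)) has_derivative (\<lambda>v. u \<bullet> (frechet_derivative ?Gc (at ?x) v *v w))) (at ?x)"
      using has_derivative_bilinear_form[OF has_derivative_const dc has_derivative_const, of u w] by simp
    have D2: "((\<lambda>y. frechet_derivative \<phi> (at y) u \<bullet> (?Gd (\<phi> y) *v frechet_derivative \<phi> (at y) w)) has_derivative
       (\<lambda>v. H v u \<bullet> (?Gd (\<phi> ?x) *v J w) + J u \<bullet> (frechet_derivative ?Gd (at (snd d p)) (J v) *v J w)
          + J u \<bullet> (?Gd (\<phi> ?x) *v H v w))) (at ?x)"
      using has_derivative_bilinear_form[OF dJ ddphi dJ, of u w] unfolding J_def .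
    have eq: "frechet_derivative \<phi> (at y) u \<bullet> (?Gd (\<phi> y) *v frechet_derivative \<phi> (at y) w) = u \<bullet> (?Gc y *v w)"
      if y: "y \<in> ?U" for y
    proof -
      let ?q = "chart_inv c y"
      have q: "c \<in> charts_at A ?q" "d \<in> charts_at A ?q" "snd c ?q = y"
        using chart_overlap(4)[OF at c d y] by auto
      have "chart_inv d (\<phi> y) = ?q" using chart_image(3)[OF at q(2)] by (simp add: \<phi>_def)
      then show ?thesis
        using metric_matrix_transition[OF M q(1,2), of u w] by (simp add: q(3) \<phi>_def)
    qed
    \<comment> \<open>D1 and D2 differentiate the two sides of the transformation law of the metric.\<close>
    from has_derivative_unique[OF D1 has_derivative_transform_within_open[OF D2 U eq]]
    have "u \<bullet> (frechet_derivative ?Gc (at ?x) v *v w) =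
        H v u \<bullet> (?Gd (\<phi> ?x) *v J w) + J u \<bullet> (frechet_derivative ?Gd (at (snd d p)) (J v) *v J w)
          + J u \<bullet> (?Gd (\<phi> ?x) *v H v w)" by metis
    also have "?Gd (\<phi> ?x) = metric_matrix A g d p"
      unfolding phix using chart_image(3)[OF at d] by simp
    also have "J u \<bullet> (frechet_derivative ?Gd (at (snd d p)) (J v) *v J w) =
       connection_form A g d p (J v) (J u) \<bullet> (metric_matrix A g d p *v J w)
         + J u \<bullet> (metric_matrix A g d p *v connection_form A g d p (J v) (J w))"
      by (rule connection_form_metric[OF M d])
    finally have "u \<bullet> (frechet_derivative ?Gc (at ?x) v *v w) =
       J (b v u) \<bullet> (metric_matrix A g d p *v J w) + J u \<bullet> (metric_matrix A g d p *v J (b v w))"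
      unfolding b_def JK by (simp only: inner_add_left inner_add_right matrix_vector_right_distrib add_ac)
    then show ?thesis
      using metric_matrix_transition[OF M c d] unfolding J_def \<phi>_def by metis
  qed
  have "b u w = connection_form A g c p u w" by (rule connection_form_unique[OF M c bil bsym met])
  then have "J (connection_form A g c p u w) = J (b u w)" by simp
  then show ?thesis unfolding b_def JK H_def .
qed

text \<open>Differentiating the relation between the coordinate expressions of Y in two charts produces a
  term with the second derivative of the transition map; it is cancelled by the inhomogeneous term
  in the transformation law of the connection form.\<close>

lemma cov_deriv_tangent:
  assumes M: "lorentzian_manifold A g" and v: "v \<in> tangent_space A p"
    and Y: "\<And>q. Y q \<in> tangent_space A q"
    and diff: "\<And>c. c \<in> charts_at A p \<Longrightarrow> (\<lambda>x. Y (chart_inv c x) c) differentiable (at (snd c p))"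
  shows "cov_deriv A g p v Y \<in> tangent_space A p"
proof -
  have at: "smooth_atlas A" using M by (simp add: lorentzian_manifold_def)
  have "cov_deriv A g p v Y d =
      frechet_derivative (snd d \<circ> chart_inv c) (at (snd c p)) (cov_deriv A g p v Y c)"
    if c: "c \<in> charts_at A p" and d: "d \<in> charts_at A p" for c d
  proof -
    define \<phi> where "\<phi> = snd d \<circ> chart_inv c"
    let ?x = "snd c p" and ?U = "snd c ` (fst c \<inter> fst d)"
    let ?Yc = "\<lambda>x. Y (chart_inv c x) c" and ?Yd = "\<lambda>x. Y (chart_inv d x) d"
    let ?J = "frechet_derivative \<phi> (at ?x)"
    note U = chart_overlap(1,2)[OF at c d]
    have sm: "smooth_on ?U \<phi>" unfolding \<phi>_def by (rule chart_overlap(3)[OF at c d])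
    have dphi: "(\<phi> has_derivative ?J) (at ?x)"
      using smooth_on_differentiable[OF sm U(2)] frechet_derivative_works by blast
    have phix: "\<phi> ?x = snd d p" using chart_image[OF at c] by (simp add: \<phi>_def)
    have dc: "(?Yc has_derivative frechet_derivative ?Yc (at ?x)) (at ?x)"
      using diff[OF c] frechet_derivative_works by blast
    have dd: "(?Yd has_derivative frechet_derivative ?Yd (at (snd d p))) (at (\<phi> ?x))"
      unfolding phix using diff[OF d] frechet_derivative_works by blast
    have D1: "((\<lambda>y. ?Yd (\<phi> y)) has_derivative (\<lambda>v. frechet_derivative ?Yd (at (snd d p)) (?J v))) (at ?x)"
      using diff_chain_at[OF dphi dd] by (simp add: o_def)
    note D2 = has_derivative_directional_derivative[OF U sm dc]
    have eq: "frechet_derivative \<phi> (at y) (?Yc y) = ?Yd (\<phi> y)" if y: "y \<in> ?U" for y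
    proof -
      let ?q = "chart_inv c y"
      have q: "c \<in> charts_at A ?q" "d \<in> charts_at A ?q" "snd c ?q = y"
        using chart_overlap(4)[OF at c d y] by auto
      have "chart_inv d (\<phi> y) = ?q" using chart_image(3)[OF at q(2)] by (simp add: \<phi>_def)
      then show ?thesis using tangent_space_transition[OF Y q(1,2)] q(3) by (simp add: \<phi>_def)
    qed
    have Yp: "?Yc ?x = Y p c" using chart_image(3)[OF at c] by simp
    have Ypd: "Y p d = ?J (Y p c)" using tangent_space_transition[OF Y c d] by (simp add: \<phi>_def)
    have vd: "v d = ?J (v c)" using tangent_space_transition[OF v c d] by (simp add: \<phi>_def)
    have der: "frechet_derivative ?Yd (at (snd d p)) (?J (v c)) =
       frechet_derivative (\<lambda>z. frechet_derivative \<phi> (at z) (Y p c)) (at ?x) (v c)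
       + ?J (frechet_derivative ?Yc (at ?x) (v c))"
      using fun_cong[OF has_derivative_unique[OF D1 has_derivative_transform_within_open[OF D2 U eq]], of "v c"]
      unfolding Yp .
    have conn: "?J (connection_form A g c p (v c) (Y p c)) =
         connection_form A g d p (v d) (Y p d)
         + frechet_derivative (\<lambda>y. frechet_derivative \<phi> (at y) (Y p c)) (at ?x) (v c)"
      unfolding vd Ypd \<phi>_def by (rule connection_form_transition[OF M c d])
    have cov: "cov_deriv A g p v Y e =
        frechet_derivative (\<lambda>x. Y (chart_inv e x) e) (at (snd e p)) (v e)
        + connection_form A g e p (v e) (Y p e)" if "e \<in> charts_at A p" for e
      by (simp only: cov_deriv_def that if_True)
    show ?thesis
      unfolding cov[OF c] cov[OF d] \<phi>_def[symmetric] linear_add[OF has_derivative_linear[OF dphi]] conn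
      by (simp only: vd der add_ac)
  qed
  moreover have "cov_deriv A g p v Y d = 0" if "d \<notin> charts_at A p" for d
    by (simp only: cov_deriv_def that if_False)
  ultimately show ?thesis unfolding tangent_space_def by blast
qed

section \<open>The gradient\<close>

lemma differentiable_det:
  fixes G :: "'a::real_normed_vector \<Rightarrow> real^'n^'n"
  assumes "\<And>i j. (\<lambda>x. G x $ i $ j) differentiable (at a)"
  shows "(\<lambda>x. det (G x)) differentiable (at a)"
proof -
  have prod: "(\<lambda>x. \<Prod>i\<in>UNIV. G x $ i $ q i) differentiable (at a)" for q :: "'n \<Rightarrow> 'n"
  proof -
    have "((\<lambda>x. G x $ i $ q i) has_derivative frechet_derivative (\<lambda>x. G x $ i $ q i) (at a)) (at a)" for i
      by (rule iffD1[OF frechet_derivative_works assms])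
    from has_derivative_prod[where I = UNIV, OF this] show ?thesis by (rule differentiableI)
  qed
  show ?thesis
    unfolding det_def
    by (rule differentiable_sum, rule finite_permutations, rule finite, rule ballI,
        rule differentiable_mult, rule differentiable_const, rule prod)
qed

lemma differentiable_vec_iff:
  fixes f :: "'a::real_normed_vector \<Rightarrow> real^'n"
  shows "f differentiable (at a) \<longleftrightarrow> (\<forall>i. (\<lambda>x. f x $ i) differentiable (at a))"
  by (subst differentiable_componentwise_within) (auto simp: Basis_vec_def inner_axis)

text \<open>By Cramer's rule the solution is a rational function of the coefficients, so no derivative
  of the inverse matrix is needed.\<close>

lemma differentiable_linear_system_solution:
  fixes G :: "'a::real_normed_vector \<Rightarrow> real^'n^'n" and e Y :: "'a \<Rightarrow> real^'n"
  assumes U: "open U" "a \<in> U"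
    and G: "G differentiable (at a)" and e: "e differentiable (at a)"
    and sol: "\<And>x. x \<in> U \<Longrightarrow> invertible (G x)" "\<And>x. x \<in> U \<Longrightarrow> G x *v Y x = e x"
  shows "Y differentiable (at a)"
proof -
  define Z where "Z x k = det (\<chi> i j. if j = k then e x $ i else G x $ i $ j) / det (G x)" for x k
  have nz: "det (G x) \<noteq> 0" if "x \<in> U" for x
    using sol(1)[OF that] invertible_det_nz by blast
  have YZ: "Y x $ k = Z x k" if "x \<in> U" for x k
    using iffD1[OF cramer[OF nz[OF that]] sol(2)[OF that]] by (simp add: Z_def)
  have Gij: "(\<lambda>x. G x $ i $ j) differentiable (at a)" for i j
  proof -
    have "(G has_derivative frechet_derivative G (at a)) (at a)"
      using G by (simp only: frechet_derivative_works)
    from bounded_linear.has_derivative[OF bounded_linear_vec_nth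
        bounded_linear.has_derivative[OF bounded_linear_vec_nth this]]
    show ?thesis by (rule differentiableI)
  qed
  have ei: "(\<lambda>x. e x $ i) differentiable (at a)" for i using e differentiable_vec_iff by blast
  have "(\<lambda>x. Z x k) differentiable (at a)" for k
  proof -
    have "(\<lambda>x. (\<chi> i j. if j = k then e x $ i else G x $ i $ j) $ i $ j) differentiable (at a)" for i j
      using ei[of i] Gij[of i j] by (cases "j = k") simp_all
    from differentiable_divide[OF differentiable_det[OF this] differentiable_det[OF Gij] nz[OF U(2)]]
    show ?thesis unfolding Z_def .
  qed
  then have "((\<lambda>x. Z x k) has_derivative frechet_derivative (\<lambda>x. Z x k) (at a)) (at a)" for k
    by (simp only: frechet_derivative_works)
  from has_derivative_transform_within_open[OF this U]
  have "((\<lambda>x. Y x $ k) has_derivative frechet_derivative (\<lambda>x. Z x k) (at a)) (at a)" for k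
    by (simp only: YZ)
  then show ?thesis using differentiable_vec_iff differentiableI by blast
qed

lemma smooth_function_differentiable:
  assumes "smooth_function A f" "c \<in> charts_at A p"
  shows "(f \<circ> chart_inv c) differentiable (at (snd c p))"
  using assms smooth_on_differentiable unfolding smooth_function_def charts_at_def by blast

text \<open>The chain rule for the transition map makes the value independent of the chart, so the
  definite description defining it has a unique solution.\<close>

lemma tvec_apply_chart:
  assumes at: "smooth_atlas A" and f: "smooth_function A f" and v: "v \<in> tangent_space A p"
    and c: "c \<in> charts_at A p"
  shows "tvec_apply A p v f = frechet_derivative (f \<circ> chart_inv c) (at (snd c p)) (v c)"
proof -
  let ?r = "\<lambda>c. frechet_derivative (f \<circ> chart_inv c) (at (snd c p)) (v c)"
  have indep: "?r d = ?r c" if d: "d \<in> charts_at A p" for d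
  proof -
    define \<phi> where "\<phi> = snd d \<circ> chart_inv c"
    have dphi: "(\<phi> has_derivative frechet_derivative \<phi> (at (snd c p))) (at (snd c p))"
      using transition_differentiable[OF at c d] frechet_derivative_works unfolding \<phi>_def by blast
    have phix: "\<phi> (snd c p) = snd d p" using chart_image[OF at c] by (simp add: \<phi>_def)
    have "((f \<circ> chart_inv d) has_derivative frechet_derivative (f \<circ> chart_inv d) (at (snd d p))) (at (\<phi> (snd c p)))"
      unfolding phix using smooth_function_differentiable[OF f d] frechet_derivative_works by blast
    note comp = diff_chain_at[OF dphi this]
    have eq: "((f \<circ> chart_inv d) \<circ> \<phi>) y = (f \<circ> chart_inv c) y" if y: "y \<in> snd c ` (fst c \<inter> fst d)" for y
    proof -
      have "d \<in> charts_at A (chart_inv c y)" using chart_overlap(4)[OF at c d y] by blast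
      from chart_image(3)[OF at this] show ?thesis by (simp add: \<phi>_def)
    qed
    have "frechet_derivative (f \<circ> chart_inv d) (at (snd d p)) \<circ> frechet_derivative \<phi> (at (snd c p))
        = frechet_derivative (f \<circ> chart_inv c) (at (snd c p))"
      by (rule frechet_derivative_at[OF has_derivative_transform_within_open[OF comp chart_overlap(1,2)[OF at c d] eq]])
    from fun_cong[OF this, of "v c"] show ?thesis
      unfolding o_apply tangent_space_transition[OF v c d, folded \<phi>_def] .
  qed
  show ?thesis
    unfolding tvec_apply_def
  proof (rule the_equality)
    show "\<forall>d\<in>charts_at A p. ?r c = ?r d" using indep by (intro ballI) (rule sym)
    show "r = ?r c" if "\<forall>d\<in>charts_at A p. r = ?r d" for r using that c by blast
  qed
qed

lemma metric_sym:
  assumes "lorentzian_manifold A g" "u \<in> tangent_space A p" "v \<in> tangent_space A p"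
  shows "g p u v = g p v u"
  using assms unfolding lorentzian_manifold_def lorentzian_metric_def by blast

lemma metric_lincomb_left:
  assumes "lorentzian_manifold A g"
    "u \<in> tangent_space A p" "v \<in> tangent_space A p" "w \<in> tangent_space A p"
  shows "g p (r *\<^sub>T u + s *\<^sub>T v) w = r * g p u w + s * g p v w"
  using assms unfolding lorentzian_manifold_def lorentzian_metric_def by blast

lemma metric_lincomb_right:
  assumes M: "lorentzian_manifold A g"
    and t: "u \<in> tangent_space A p" "v \<in> tangent_space A p" "w \<in> tangent_space A p"
  shows "g p w (r *\<^sub>T u + s *\<^sub>T v) = r * g p w u + s * g p w v"
proof -
  have at: "smooth_atlas A" using M by (simp add: lorentzian_manifold_def)
  show ?thesis
    unfolding metric_sym[OF M t(3) tangent_space_lincomb[OF at t(1,2)]] metric_lincomb_left[OF M t]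
      metric_sym[OF M t(1,3)] metric_sym[OF M t(2,3)] ..
qed

text \<open>The gradient is the solution of a linear system with the metric matrix in any one chart;
  existence and uniqueness both come from invertibility of that matrix.\<close>

lemma gradient_works:
  assumes M: "lorentzian_manifold A g" and f: "smooth_function A f"
  shows "gradient A g f p \<in> tangent_space A p"
    and "\<And>v. v \<in> tangent_space A p \<Longrightarrow> g p (gradient A g f p) v = tvec_apply A p v f"
proof -
  have at: "smooth_atlas A" using M by (simp add: lorentzian_manifold_def)
  then obtain c where c: "c \<in> charts_at A p" unfolding smooth_atlas_def charts_at_def by blast
  let ?G = "metric_matrix A g c p" and ?D = "frechet_derivative (f \<circ> chart_inv c) (at (snd c p))"
  let ?P = "\<lambda>w. w \<in> tangent_space A p \<and> (\<forall>v\<in>tangent_space A p. g p w v = tvec_apply A p v f)"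
  define e :: "real^4" where "e = (\<chi> i. ?D (axis i 1))"
  have linD: "linear ?D" by (rule linear_frechet_derivative[OF smooth_function_differentiable[OF f c]])
  have e: "u \<bullet> e = ?D u" for u
  proof (rule linear_eq_axis[OF _ linD])
    show "linear (\<lambda>u. u \<bullet> e)" by (auto intro!: linearI simp: inner_add_left)
    show "axis i 1 \<bullet> e = ?D (axis i 1)" for i by (simp add: e_def inner_axis')
  qed
  obtain G' where "?G ** G' = mat 1"
    using metric_matrix_invertible[OF M c] unfolding invertible_def by blast
  then have G': "?G *v (G' *v x) = x" for x by (simp add: matrix_vector_mul_assoc)
  obtain w where w: "w \<in> tangent_space A p" "w c = G' *v e"
    using tangent_vector_with_coordinates[OF at c] .
  have "g p w v = tvec_apply A p v f" if v: "v \<in> tangent_space A p" for v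
    unfolding metric_sym[OF M w(1) v] metric_matrix_form[OF M c v w(1)] w(2) G' e
      tvec_apply_chart[OF at f v c] ..
  with w(1) have Pw: "?P w" by blast
  have uniq: "x = w" if Px: "?P x" for x
  proof -
    have "g p (1 *\<^sub>T x + (-1) *\<^sub>T w) v = 0" if v: "v \<in> tangent_space A p" for v
      using metric_lincomb_left[OF M _ w(1) v, of x 1 "-1"] Px Pw v by simp
    from tangent_vector_eq_0[OF M tangent_space_lincomb[OF at _ w(1)] this c]
    have "x c = w c" using Px by (simp add: scale_tvec_def)
    then show ?thesis using tangent_vector_eqI[OF _ w(1) c] Px by blast
  qed
  have "?P (gradient A g f p)" unfolding gradient_def by (rule theI[of ?P, OF Pw uniq])
  then show "gradient A g f p \<in> tangent_space A p"
    and "\<And>v. v \<in> tangent_space A p \<Longrightarrow> g p (gradient A g f p) v = tvec_apply A p v f" by blast+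
qed

lemma gradient_coordinates:
  assumes M: "lorentzian_manifold A g" and f: "smooth_function A f" and c: "c \<in> charts_at A p"
  shows "metric_matrix A g c p *v gradient A g f p c =
         (\<chi> i. frechet_derivative (f \<circ> chart_inv c) (at (snd c p)) (axis i 1))"
proof (rule vec_eq_iff[THEN iffD2], rule allI)
  fix i
  have at: "smooth_atlas A" using M by (simp add: lorentzian_manifold_def)
  note grad = gradient_works[OF M f]
  obtain v where v: "v \<in> tangent_space A p" "v c = axis i 1"
    using tangent_vector_with_coordinates[OF at c] .
  have "(metric_matrix A g c p *v gradient A g f p c) $ i = v c \<bullet> (metric_matrix A g c p *v gradient A g f p c)"
    by (simp add: v(2) inner_axis')
  also have "\<dots> = tvec_apply A p v f"
    unfolding metric_matrix_form[OF M c v(1) grad(1), symmetric] metric_sym[OF M v(1) grad(1)] grad(2)[OF v(1)] ..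
  also have "\<dots> = frechet_derivative (f \<circ> chart_inv c) (at (snd c p)) (axis i 1)"
    unfolding tvec_apply_chart[OF at f v(1) c] v(2) ..
  finally show "(metric_matrix A g c p *v gradient A g f p c) $ i =
      (\<chi> i. frechet_derivative (f \<circ> chart_inv c) (at (snd c p)) (axis i 1)) $ i" by simp
qed

lemma gradient_differentiable:
  assumes M: "lorentzian_manifold A g" and f: "smooth_function A f" and c: "c \<in> charts_at A p"
  shows "(\<lambda>x. gradient A g f (chart_inv c x) c) differentiable (at (snd c p))"
proof (rule differentiable_linear_system_solution)
  have at: "smooth_atlas A" using M by (simp add: lorentzian_manifold_def)
  note chart_image[OF at c]
  then show "open (snd c ` fst c)" "snd c p \<in> snd c ` fst c" by blast+
  show "metric_rep A g c differentiable (at (snd c p))" by (rule metric_rep_differentiable[OF M c])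
  let ?e = "\<lambda>x. \<chi> i. frechet_derivative (f \<circ> chart_inv c) (at x) (axis i 1)"
  have "smooth_on (snd c ` fst c) (f \<circ> chart_inv c)"
    using f c by (simp add: smooth_function_def charts_at_def)
  from smooth_on_differentiable[OF smooth_on_directional_derivative[OF this]]
  show "?e differentiable (at (snd c p))"
    unfolding differentiable_vec_iff using chart_image(2)[OF at c] by simp
  fix x assume "x \<in> snd c ` fst c"
  then have x: "c \<in> charts_at A (chart_inv c x)" "snd c (chart_inv c x) = x"
    using chart_overlap(4)[OF at c c] by simp_all
  show "invertible (metric_rep A g c x)" using metric_matrix_invertible[OF M x(1)] by simp
  show "metric_rep A g c x *v gradient A g f (chart_inv c x) c = ?e x"
    using gradient_coordinates[OF M f x(1)] by (simp add: x(2))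
qed

text \<open>A vanishing Hessian makes the gradient parallel: its covariant derivative is a tangent vector
  orthogonal to all tangent vectors.\<close>

lemma cov_deriv_gradient_eq_0:
  assumes M: "lorentzian_manifold A g" and f: "smooth_function A f" and H: "vanishing_hessian A g f"
    and v: "v \<in> tangent_space A p" and c: "c \<in> charts_at A p"
  shows "cov_deriv A g p v (gradient A g f) c = 0"
proof (rule tangent_vector_eq_0[OF M _ _ c])
  show "cov_deriv A g p v (gradient A g f) \<in> tangent_space A p"
    by (rule cov_deriv_tangent[OF M v gradient_works(1)[OF M f] gradient_differentiable[OF M f]])
  show "g p (cov_deriv A g p v (gradient A g f)) w = 0" if "w \<in> tangent_space A p" for w
    using H v that unfolding vanishing_hessian_def hessian_def by blast
qed

section \<open>Fields along a curve\<close>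

lemma curve_chart_domain_open:
  assumes "smooth_atlas A" "open I" "smooth_curve A I \<alpha>" "c \<in> A"
  shows "open {t \<in> I. \<alpha> t \<in> fst c}"
proof -
  have "open (fst c)" using assms(1,4) unfolding smooth_atlas_def by blast
  moreover have "continuous_on I \<alpha>" using assms(3) by (simp add: smooth_curve_def)
  ultimately have "open (I \<inter> \<alpha> -` fst c)" using assms(2) continuous_open_preimage by blast
  then show ?thesis by (simp add: Int_def vimage_def)
qed

lemma curve_has_vector_derivative:
  assumes \<alpha>: "smooth_curve A I \<alpha>" and t: "t \<in> I" and c: "c \<in> charts_at A (\<alpha> t)"
  shows "((snd c \<circ> \<alpha>) has_vector_derivative velocity A \<alpha> t c) (at t)"
proof -
  have "smooth_on {t \<in> I. \<alpha> t \<in> fst c} (snd c \<circ> \<alpha>)"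
    using \<alpha> c unfolding smooth_curve_def charts_at_def by blast
  then have "(snd c \<circ> \<alpha>) differentiable (at t)"
    by (rule smooth_on_differentiable) (use t c in \<open>simp add: charts_at_def\<close>)
  then have "((snd c \<circ> \<alpha>) has_vector_derivative vector_derivative (snd c \<circ> \<alpha>) (at t)) (at t)"
    by (simp only: vector_derivative_works)
  then show ?thesis by (simp only: velocity_def c if_True)
qed

lemma velocity_tangent:
  assumes at: "smooth_atlas A" and I: "open I" and \<alpha>: "smooth_curve A I \<alpha>" and t: "t \<in> I"
  shows "velocity A \<alpha> t \<in> tangent_space A (\<alpha> t)"
proof -
  have "velocity A \<alpha> t d = frechet_derivative (snd d \<circ> chart_inv c) (at (snd c (\<alpha> t))) (velocity A \<alpha> t c)"
    if c: "c \<in> charts_at A (\<alpha> t)" and d: "d \<in> charts_at A (\<alpha> t)" for c d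
  proof -
    let ?\<phi> = "snd d \<circ> chart_inv c"
    let ?S = "{t \<in> I. \<alpha> t \<in> fst c} \<inter> {t \<in> I. \<alpha> t \<in> fst d}"
    have cA: "c \<in> A" and dA: "d \<in> A" using c d by (simp_all add: charts_at_def)
    have S: "open ?S"
      by (rule open_Int[OF curve_chart_domain_open[OF at I \<alpha> cA] curve_chart_domain_open[OF at I \<alpha> dA]])
    have tS: "t \<in> ?S" using c d t by (simp add: charts_at_def)
    have dphi: "(?\<phi> has_derivative frechet_derivative ?\<phi> (at (snd c (\<alpha> t)))) (at ((snd c \<circ> \<alpha>) t))"
      unfolding o_apply[of "snd c" \<alpha>]
      by (rule iffD1[OF frechet_derivative_works transition_differentiable[OF at c d]])
    note comp = diff_chain_at[OF curve_has_vector_derivative[OF \<alpha> t c, unfolded has_vector_derivative_def] dphi]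
    have "frechet_derivative ?\<phi> (at (snd c (\<alpha> t))) \<circ> (\<lambda>h. h *\<^sub>R velocity A \<alpha> t c) =
        (\<lambda>h. h *\<^sub>R frechet_derivative ?\<phi> (at (snd c (\<alpha> t))) (velocity A \<alpha> t c))"
      by (rule ext) (simp only: o_apply linear_cmul[OF has_derivative_linear[OF dphi]])
    then have "((?\<phi> \<circ> (snd c \<circ> \<alpha>)) has_vector_derivative
        frechet_derivative ?\<phi> (at (snd c (\<alpha> t))) (velocity A \<alpha> t c)) (at t)"
      unfolding has_vector_derivative_def by (rule has_derivative_eq_rhs[OF comp])
    moreover have "(?\<phi> \<circ> (snd c \<circ> \<alpha>)) s = (snd d \<circ> \<alpha>) s" if "s \<in> ?S" for s
    proof -
      have "\<alpha> s \<in> fst c" using that by blast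
      from chart_inv_left[OF this at cA] show ?thesis by simp
    qed
    ultimately have "((snd d \<circ> \<alpha>) has_vector_derivative
        frechet_derivative ?\<phi> (at (snd c (\<alpha> t))) (velocity A \<alpha> t c)) (at t)"
      by (rule has_vector_derivative_transform_within_open[OF _ S tS])
    from vector_derivative_unique_at[OF curve_has_vector_derivative[OF \<alpha> t d] this]
    show ?thesis .
  qed
  moreover have "velocity A \<alpha> t c = 0" if "c \<notin> charts_at A (\<alpha> t)" for c
    by (simp only: velocity_def that if_False)
  ultimately show ?thesis unfolding tangent_space_def by blast
qed

lemma velocity_differentiable:
  assumes at: "smooth_atlas A" and I: "open I" and \<alpha>: "smooth_curve A I \<alpha>" and t: "t \<in> I"
    and c: "c \<in> charts_at A (\<alpha> t)"
  shows "(\<lambda>s. velocity A \<alpha> s c) differentiable (at t)"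
proof -
  let ?S = "{t \<in> I. \<alpha> t \<in> fst c}"
  have S: "open ?S" "t \<in> ?S"
    using curve_chart_domain_open[OF at I \<alpha>] c t by (auto simp: charts_at_def)
  have sm: "smooth_on ?S (snd c \<circ> \<alpha>)"
    using \<alpha> c unfolding smooth_curve_def charts_at_def by blast
  have D: "((\<lambda>s. frechet_derivative (snd c \<circ> \<alpha>) (at s) 1) has_derivative
      frechet_derivative (\<lambda>s. frechet_derivative (snd c \<circ> \<alpha>) (at s) 1) (at t)) (at t)"
    by (rule iffD1[OF frechet_derivative_works
          smooth_on_differentiable[OF smooth_on_directional_derivative[OF sm] S(2)]])
  have eq: "frechet_derivative (snd c \<circ> \<alpha>) (at s) 1 = velocity A \<alpha> s c" if s: "s \<in> ?S" for s
  proof -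
    have "s \<in> I" "c \<in> charts_at A (\<alpha> s)" using s c by (simp_all add: charts_at_def)
    note curve_has_vector_derivative[OF \<alpha> this, unfolded has_vector_derivative_def]
    from fun_cong[OF frechet_derivative_at[OF this], of 1] show ?thesis by simp
  qed
  show ?thesis by (rule differentiableI[OF has_derivative_transform_within_open[OF D S eq]])
qed

text \<open>The product rule for the Levi-Civita connection along a curve, where the term that contains
  the derivative of the gradient is absent because the gradient is parallel. In a chart, the derivative
  of the coordinates of the gradient along the velocity is minus the connection term, and
  \<open>connection_form_metric\<close> splits the derivative of the metric matrix into two connection terms; one
  cancels that, the other completes the derivative of V to the covariant derivative.\<close>

lemma has_real_derivative_gradient_along:
  assumes M: "lorentzian_manifold A g" and f: "smooth_function A f" and H: "vanishing_hessian A g f"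
    and I: "open I" and \<alpha>: "smooth_curve A I \<alpha>" and t: "t \<in> I"
    and V: "\<And>s. s \<in> I \<Longrightarrow> V s \<in> tangent_space A (\<alpha> s)"
    and dV: "\<And>c. c \<in> charts_at A (\<alpha> t) \<Longrightarrow> (\<lambda>s. V s c) differentiable (at t)"
    and V': "cov_deriv_along A g \<alpha> V t \<in> tangent_space A (\<alpha> t)"
  shows "((\<lambda>s. g (\<alpha> s) (gradient A g f (\<alpha> s)) (V s)) has_real_derivative
          g (\<alpha> t) (gradient A g f (\<alpha> t)) (cov_deriv_along A g \<alpha> V t)) (at t)"
proof -
  have at: "smooth_atlas A" using M by (simp add: lorentzian_manifold_def)
  then obtain c where c: "c \<in> charts_at A (\<alpha> t)" unfolding smooth_atlas_def charts_at_def by blast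
  let ?S = "{t \<in> I. \<alpha> t \<in> fst c}" and ?x = "snd c \<circ> \<alpha>" and ?p = "\<alpha> t"
  let ?v = "velocity A \<alpha> t c" and ?W = "vector_derivative (\<lambda>s. V s c) (at t)"
  define Y where "Y = (\<lambda>x. gradient A g f (chart_inv c x) c)"
  let ?DY = "frechet_derivative Y (at (snd c ?p))"
  let ?G = "metric_rep A g c" and ?DG = "frechet_derivative (metric_rep A g c) (at (snd c ?p))"
  let ?B = "connection_form A g c ?p"
  have S: "open ?S" "t \<in> ?S"
    using curve_chart_domain_open[OF at I \<alpha>] c t by (auto simp: charts_at_def)
  have inv: "chart_inv c (?x s) = \<alpha> s" "c \<in> charts_at A (\<alpha> s)" if "s \<in> ?S" for s
    using that c chart_inv_left[OF _ at] by (auto simp: charts_at_def)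
  have dx: "(?x has_derivative (\<lambda>h. h *\<^sub>R ?v)) (at t)"
    using curve_has_vector_derivative[OF \<alpha> t c] unfolding has_vector_derivative_def .
  have dW: "((\<lambda>s. V s c) has_derivative (\<lambda>h. h *\<^sub>R ?W)) (at t)"
    using dV[OF c] unfolding vector_derivative_works has_vector_derivative_def .
  have dY: "(Y has_derivative ?DY) (at (?x t))"
    unfolding o_apply Y_def by (rule iffD1[OF frechet_derivative_works gradient_differentiable[OF M f c]])
  have dG: "(?G has_derivative ?DG) (at (?x t))"
    by (subst o_apply) (rule iffD1[OF frechet_derivative_works metric_rep_differentiable[OF M c]])
  have dYx: "((\<lambda>s. Y (?x s)) has_derivative (\<lambda>h. ?DY (h *\<^sub>R ?v))) (at t)"
    using diff_chain_at[OF dx dY] by (simp only: o_def)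
  have dGx: "((\<lambda>s. ?G (?x s)) has_derivative (\<lambda>h. ?DG (h *\<^sub>R ?v))) (at t)"
    using diff_chain_at[OF dx dG] by (simp only: o_def)
  have Yt: "Y (?x t) = gradient A g f ?p c" and Gt: "?G (?x t) = metric_matrix A g c ?p"
    using inv[OF S(2)] by (simp_all add: Y_def)
  have "?DY ?v + ?B ?v (gradient A g f ?p c) = 0"
    using cov_deriv_gradient_eq_0[OF M f H velocity_tangent[OF at I \<alpha> t] c]
    unfolding cov_deriv_def Y_def by (simp only: c if_True)
  then have DYv: "?DY ?v = - ?B ?v (Y (?x t))" by (simp only: Yt eq_neg_iff_add_eq_0)
  have cdV: "cov_deriv_along A g \<alpha> V t c = ?W + ?B ?v (V t c)"
    unfolding cov_deriv_along_def by (simp only: c if_True)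
  have val: "?DY ?v \<bullet> (?G (?x t) *v V t c) + Y (?x t) \<bullet> (?DG ?v *v V t c) + Y (?x t) \<bullet> (?G (?x t) *v ?W)
      = g ?p (gradient A g f ?p) (cov_deriv_along A g \<alpha> V t)"
    unfolding metric_matrix_form[OF M c gradient_works(1)[OF M f] V'] cdV DYv Gt
      connection_form_metric[OF M c] Yt[symmetric]
    by (simp only: matrix_vector_right_distrib inner_add_right inner_minus_left)
  have "((\<lambda>s. Y (?x s) \<bullet> (?G (?x s) *v V s c)) has_derivative
     (\<lambda>h. ?DY (h *\<^sub>R ?v) \<bullet> (?G (?x t) *v V t c) + Y (?x t) \<bullet> (?DG (h *\<^sub>R ?v) *v V t c)
        + Y (?x t) \<bullet> (?G (?x t) *v (h *\<^sub>R ?W)))) (at t)"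
    by (rule has_derivative_bilinear_form[OF dYx dGx dW])
  also have "(\<lambda>h. ?DY (h *\<^sub>R ?v) \<bullet> (?G (?x t) *v V t c) + Y (?x t) \<bullet> (?DG (h *\<^sub>R ?v) *v V t c)
        + Y (?x t) \<bullet> (?G (?x t) *v (h *\<^sub>R ?W)))
     = (*) (g ?p (gradient A g f ?p) (cov_deriv_along A g \<alpha> V t))"
    unfolding val[symmetric] linear_cmul[OF has_derivative_linear[OF dY]]
      linear_cmul[OF has_derivative_linear[OF dG]] scaleR_matrix_vector_assoc[symmetric]
      matrix_vector_mult_scaleR inner_scaleR_left inner_scaleR_right
    by (intro ext) (simp only: distrib_left distrib_right mult.commute)
  finally have D: "((\<lambda>s. Y (?x s) \<bullet> (?G (?x s) *v V s c)) has_real_derivative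
     g ?p (gradient A g f ?p) (cov_deriv_along A g \<alpha> V t)) (at t)"
    unfolding has_field_derivative_def .
  show ?thesis
  proof (rule has_field_derivative_transform_within_open[OF D S])
    fix s assume s: "s \<in> ?S"
    then have "V s \<in> tangent_space A (\<alpha> s)" using V by blast
    from metric_matrix_form[OF M inv(2)[OF s] gradient_works(1)[OF M f] this]
    show "Y (?x s) \<bullet> (?G (?x s) *v V s c) = g (\<alpha> s) (gradient A g f (\<alpha> s)) (V s)"
      by (simp only: Y_def inv(1)[OF s] o_apply[of "metric_matrix A g c"])
  qed
qed

lemma smooth_field_along_differentiable:
  assumes "smooth_field_along A I \<alpha> V" "t \<in> I" "c \<in> charts_at A (\<alpha> t)"
  shows "(\<lambda>s. V s c) differentiable (at t)"
proof -
  have "smooth_on {t \<in> I. \<alpha> t \<in> fst c} (\<lambda>s. V s c)"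
    using assms unfolding smooth_field_along_def charts_at_def by blast
  then show ?thesis by (rule smooth_on_differentiable) (use assms in \<open>simp add: charts_at_def\<close>)
qed

section \<open>The gradient along a null slant helix\<close>

theorem theorem4:
  fixes A :: "'m::{t2_space,second_countable_topology} chart set"
    and g :: "'m metric"
    and I :: "real set"
    and \<alpha> :: "real \<Rightarrow> 'm"
    and \<xi> N W1 W2 :: "real \<Rightarrow> 'm tvec"
    and \<sigma>1 \<sigma>2 :: "real \<Rightarrow> real"
    and f :: "'m \<Rightarrow> real"
  assumes "lorentzian_manifold A g"
    and "open I" and "is_interval I"
    and "cartan_curve A g I \<alpha>"
    and "pseudo_arc_parametrized A g I \<alpha>"
    and "frenet_frame A g I \<alpha> \<xi> N W1 W2 \<sigma>1 \<sigma>2"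
    and "smooth_function A f"
    and "eikonal_along A g I \<alpha> f"
    and "vanishing_hessian A g f"
    and "null_eikonal_slant_helix A g I \<alpha> N f"
  shows "let a1 = (\<lambda>t. g (\<alpha> t) (gradient A g f (\<alpha> t)) (\<xi> t));
             a2 = (\<lambda>t. g (\<alpha> t) (gradient A g f (\<alpha> t)) (W1 t));
             a3 = (\<lambda>t. g (\<alpha> t) (gradient A g f (\<alpha> t)) (W2 t))
         in \<exists>c. c \<noteq> 0 \<and> (\<forall>t\<in>I.
              c = g (\<alpha> t) (gradient A g f (\<alpha> t)) (N t) \<and>
              a1 differentiable (at t) \<and> a2 differentiable (at t) \<and> a3 differentiable (at t) \<and>
              a2 t * \<sigma>1 t + a3 t * \<sigma>2 t = 0 \<and>
              deriv a1 t - a2 t = 0 \<and>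
              deriv a2 t + a1 t * \<sigma>1 t + c = 0 \<and>
              deriv a3 t + a1 t * \<sigma>2 t = 0)"
proof -
  note M = assms(1) and I = assms(2) and frame = assms(6) and f = assms(7) and H = assms(9)
  have at: "smooth_atlas A" using M by (simp add: lorentzian_manifold_def)
  have \<alpha>: "smooth_curve A I \<alpha>" using assms(4) by (simp add: cartan_curve_def null_curve_def)
  define X where "X t = gradient A g f (\<alpha> t)" for t
  have X: "X t \<in> tangent_space A (\<alpha> t)" for t unfolding X_def by (rule gradient_works(1)[OF M f])
  have \<xi>: "\<xi> = velocity A \<alpha>" and N: "smooth_field_along A I \<alpha> N"
    and W1: "smooth_field_along A I \<alpha> W1" and W2: "smooth_field_along A I \<alpha> W2"
    using frame unfolding frenet_frame_def by blast+
  have tan: "\<xi> t \<in> tangent_space A (\<alpha> t)" "N t \<in> tangent_space A (\<alpha> t)"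
    "W1 t \<in> tangent_space A (\<alpha> t)" "W2 t \<in> tangent_space A (\<alpha> t)" if "t \<in> I" for t
    using that N W1 W2 velocity_tangent[OF at I \<alpha> that] unfolding \<xi> smooth_field_along_def by blast+
  obtain c where c: "c \<noteq> 0" "\<And>t. t \<in> I \<Longrightarrow> g (\<alpha> t) (X t) (N t) = c"
    using assms(10) unfolding null_eikonal_slant_helix_def X_def by blast
  let ?a1 = "\<lambda>t. g (\<alpha> t) (X t) (\<xi> t)" and ?a2 = "\<lambda>t. g (\<alpha> t) (X t) (W1 t)"
    and ?a3 = "\<lambda>t. g (\<alpha> t) (X t) (W2 t)"
  have main: "(?a1 has_real_derivative ?a2 t) (at t) \<and>
      (?a2 has_real_derivative - \<sigma>1 t * ?a1 t - c) (at t) \<and>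
      (?a3 has_real_derivative - \<sigma>2 t * ?a1 t) (at t) \<and>
      \<sigma>1 t * ?a2 t + \<sigma>2 t * ?a3 t = 0" if t: "t \<in> I" for t
  proof -
    \<comment> \<open>Written as combinations of two vectors, with zero coefficients where needed, the four
        Frenet equations are instances of the one rule D.\<close>
    have nabla: "cov_deriv_along A g \<alpha> \<xi> t = 1 *\<^sub>T W1 t + 0 *\<^sub>T W1 t"
      "cov_deriv_along A g \<alpha> N t = \<sigma>1 t *\<^sub>T W1 t + \<sigma>2 t *\<^sub>T W2 t"
      "cov_deriv_along A g \<alpha> W1 t = (- \<sigma>1 t) *\<^sub>T \<xi> t + (- 1) *\<^sub>T N t"
      "cov_deriv_along A g \<alpha> W2 t = (- \<sigma>2 t) *\<^sub>T \<xi> t + 0 *\<^sub>T \<xi> t"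
      using frame t unfolding frenet_frame_def by (simp_all add: scale_tvec_def fun_eq_iff)
    have D: "((\<lambda>s. g (\<alpha> s) (X s) (V s)) has_real_derivative
        r * g (\<alpha> t) (X t) u + q * g (\<alpha> t) (X t) w) (at t)"
      if V: "\<And>s. s \<in> I \<Longrightarrow> V s \<in> tangent_space A (\<alpha> s)"
        "\<And>c. c \<in> charts_at A (\<alpha> t) \<Longrightarrow> (\<lambda>s. V s c) differentiable (at t)"
        and V': "cov_deriv_along A g \<alpha> V t = r *\<^sub>T u + q *\<^sub>T w"
        and uw: "u \<in> tangent_space A (\<alpha> t)" "w \<in> tangent_space A (\<alpha> t)" for V r q u w
      using has_real_derivative_gradient_along[OF M f H I \<alpha> t V, unfolded V', OF _ _ tangent_space_lincomb[OF at uw]]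
      unfolding X_def metric_lincomb_right[OF M uw gradient_works(1)[OF M f]] .
    have d1: "(?a1 has_real_derivative ?a2 t) (at t)"
      using D[OF tan(1) _ nabla(1) tan(3)[OF t] tan(3)[OF t]] velocity_differentiable[OF at I \<alpha> t]
      unfolding \<xi> by simp
    have d2: "(?a2 has_real_derivative - \<sigma>1 t * ?a1 t - c) (at t)"
      using D[OF tan(3) smooth_field_along_differentiable[OF W1 t] nabla(3) tan(1)[OF t] tan(2)[OF t]] c(2)[OF t]
      by simp
    have d3: "(?a3 has_real_derivative - \<sigma>2 t * ?a1 t) (at t)"
      using D[OF tan(4) smooth_field_along_differentiable[OF W2 t] nabla(4) tan(1)[OF t] tan(1)[OF t]] by simp
    have "((\<lambda>s. g (\<alpha> s) (X s) (N s)) has_real_derivative \<sigma>1 t * ?a2 t + \<sigma>2 t * ?a3 t) (at t)"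
      by (rule D[OF tan(2) smooth_field_along_differentiable[OF N t] nabla(2) tan(3)[OF t] tan(4)[OF t]])
    moreover have "((\<lambda>s. g (\<alpha> s) (X s) (N s)) has_real_derivative 0) (at t)"
      by (rule has_field_derivative_transform_within_open[OF DERIV_const I t]) (simp add: c(2))
    ultimately have "\<sigma>1 t * ?a2 t + \<sigma>2 t * ?a3 t = 0" by (rule DERIV_unique)
    with d1 d2 d3 show ?thesis by blast
  qed
  show ?thesis
    unfolding Let_def X_def[symmetric]
  proof (intro exI[of _ c] conjI ballI c(1))
    fix t assume t: "t \<in> I"
    note d = main[OF t]
    show "c = g (\<alpha> t) (X t) (N t)" using c(2)[OF t] by simp
    show "?a1 differentiable (at t)" "?a2 differentiable (at t)" "?a3 differentiable (at t)"
      using d by (auto simp: real_differentiable_def)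
    show "?a2 t * \<sigma>1 t + ?a3 t * \<sigma>2 t = 0" using d by (simp add: mult.commute)
    show "deriv ?a1 t - ?a2 t = 0" using d DERIV_imp_deriv by fastforce
    show "deriv ?a2 t + ?a1 t * \<sigma>1 t + c = 0" using d DERIV_imp_deriv by fastforce
    show "deriv ?a3 t + ?a1 t * \<sigma>2 t = 0" using d DERIV_imp_deriv by fastforce
  qed
qed

end
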